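(* Let $b\ge 2$ be an integer, let $\alpha,\lambda>0$, and let $X$ be a symmetric real random variable with $\mathbb{E}[X]=0$, $\mathbb{E}[X^2]=1$ and $\lim_{x\to\infty}x^{-\alpha}\log\mathbb{P}(X>x)=-\lambda$. Let $Y_n$, $n\ge1$, be the rescaled displacement fields defined in the context. Then $\{Y_n\}_{n\ge1}$ satisfies a full large-deviation principle on the normed space $(\mathcal{H}_b,\|\cdot\|_b)$ with speed $n^{\alpha/2}$ and good rate function $\mathcal{I}_\alpha(h)=\lambda\sum_{v\ne\varnothing}|h_v|^\alpha$ (with value $\infty$ if the series diverges).
   Context: $\mathbb{T}_b=\bigcup_{k\ge0}\{1,\dots,b\}^k$ is the rooted $b$-ary tree with root $\varnothing$; $|v|$ is the generation (length) of $v$. $\mathcal{H}_b$ is the set of real fields $h=(h_v)_{v\in\mathbb{T}_b}$ with $h_\varnothing=0$ and $\|h\|_b:=\sum_{k\ge1}b^{-k}\sum_{|v|=k}|h_v|<\infty$. $(X_v)_{v\ne\varnothing}$ are i.i.d. copies of $X$. Fix a constant $c$ with $\frac{\alpha}{2\log b}<c<\frac{\alpha}{2(1-\alpha)\log b}$ if $0<\alpha<1$, and $c>\frac{\alpha}{2\log b}$ if $\alpha\ge1$. Put $k_n=\min\{\lfloor c\log n\rfloor,n-1\}$ and $m_n=n-k_n>0$. The rescaled displacement field is the $\mathcal{H}_b$-valued random element $Y_n(v)=\frac{X_v}{\sqrt{m_n}}\mathbf{1}_{\{|v|\le k_n\}}$ for $v\ne\varnothing$, $Y_n(\varnothing)=0$.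 Full LDP on a metric space $E$ with speed $a_n\to\infty$ and rate function $I:E\to[0,\infty]$ (lower semicontinuous): for every Borel $\Gamma\subset E$, $-\inf_{\Gamma^\circ}I\le\liminf_n a_n^{-1}\log\mathbb{P}(V_n\in\Gamma)\le\limsup_n a_n^{-1}\log\mathbb{P}(V_n\in\Gamma)\le-\inf_{\overline\Gamma}I$. The rate function is good if all sublevel sets $\{I\le L\}$, $L\ge0$, are compact. *)

theory Defs
  imports "HOL-Probability.Probability"
begin

section \<open>Large deviation principles\<close>

definition borel_of :: "'e topology \<Rightarrow> 'e measure" where
  "borel_of T = sigma (topspace T) {U. openin T U}"

text \<open>The extended logarithm on \<open>[0, \<infinity>)\<close>. It is needed because the library has \<open>ln 0 = 0\<close>, whereas
  \<open>log 0 = -\<infinity>\<close> is meant when an event has probability zero.\<close>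

definition ext_ln :: "real \<Rightarrow> ereal" where
  "ext_ln p = (if p \<le> 0 then - \<infinity> else ereal (ln p))"

text \<open>Lower semicontinuity is stated through open strict superlevel sets.\<close>

definition rate_function :: "'e topology \<Rightarrow> ('e \<Rightarrow> ennreal) \<Rightarrow> bool" where
  "rate_function T I \<longleftrightarrow> (\<forall>a. openin T {x \<in> topspace T. a < I x})"

definition good_rate_function :: "'e topology \<Rightarrow> ('e \<Rightarrow> ennreal) \<Rightarrow> bool" where
  "good_rate_function T I \<longleftrightarrow>
     rate_function T I \<and> (\<forall>L::real. 0 \<le> L \<longrightarrow> compactin T {x \<in> topspace T. I x \<le> ennreal L})"

text \<open>In \<open>ennreal\<close> the infimum over the empty set is \<open>\<infinity>\<close>. As \<open>a n \<rightarrow> \<infinity>\<close>, finitely many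
  indices (in particular \<open>n = 0\<close>) have no influence on the bounds.\<close>

definition LDP ::
  "'a measure \<Rightarrow> 'e topology \<Rightarrow> (nat \<Rightarrow> 'a \<Rightarrow> 'e) \<Rightarrow> (nat \<Rightarrow> real) \<Rightarrow> ('e \<Rightarrow> ennreal) \<Rightarrow> bool" where
  "LDP M T V a I \<longleftrightarrow>
     prob_space M \<and>
     (\<forall>n. V n \<in> measurable M (borel_of T)) \<and>
     filterlim a at_top sequentially \<and>
     rate_function T I \<and>
     (\<forall>\<Gamma> \<in> sets (borel_of T).
        - enn2ereal (INF x \<in> T interior_of \<Gamma>. I x)
          \<le> liminf (\<lambda>n. ereal (1 / a n) * ext_ln (measure M {\<omega> \<in> space M. V n \<omega> \<in> \<Gamma>})) \<and>
        liminf (\<lambda>n. ereal (1 / a n) * ext_ln (measure M {\<omega> \<in> space M. V n \<omega> \<in> \<Gamma>}))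
          \<le> limsup (\<lambda>n. ereal (1 / a n) * ext_ln (measure M {\<omega> \<in> space M. V n \<omega> \<in> \<Gamma>})) \<and>
        limsup (\<lambda>n. ereal (1 / a n) * ext_ln (measure M {\<omega> \<in> space M. V n \<omega> \<in> \<Gamma>}))
          \<le> - enn2ereal (INF x \<in> T closure_of \<Gamma>. I x))"


section \<open>Fields on the rooted b-ary tree\<close>

definition tree_level :: "nat \<Rightarrow> nat \<Rightarrow> nat list set" where
  "tree_level b k = {v. length v = k \<and> set v \<subseteq> {1..b}}"

definition tree :: "nat \<Rightarrow> nat list set" where
  "tree b = (\<Union>k. tree_level b k)"

definition field_norm :: "nat \<Rightarrow> (nat list \<Rightarrow> real) \<Rightarrow> real" where
  "field_norm b h = (\<Sum>\<^sub>\<infinity>k\<in>{1..}. (\<Sum>v\<in>tree_level b k. \<bar>h v\<bar>) / real b ^ k)"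

text \<open>A field is indexed by \<open>tree b\<close>; as a total function on lists it is taken to vanish off the
  tree, so that distinct elements of \<open>field_space b\<close> are distinct fields. The summability condition
  is \<open>\<parallel>h\<parallel>\<^sub>b < \<infinity>\<close> (the terms are nonnegative).\<close>

definition field_space :: "nat \<Rightarrow> (nat list \<Rightarrow> real) set" where
  "field_space b = {h. h [] = 0 \<and> (\<forall>v. v \<notin> tree b \<longrightarrow> h v = 0) \<and>
     (\<lambda>k. (\<Sum>v\<in>tree_level b k. \<bar>h v\<bar>) / real b ^ k) summable_on {1..}}"

definition field_dist :: "nat \<Rightarrow> (nat list \<Rightarrow> real) \<Rightarrow> (nat list \<Rightarrow> real) \<Rightarrow> real" where
  "field_dist b g h = field_norm b (\<lambda>v. g v - h v)"

definition field_topology :: "nat \<Rightarrow> (nat list \<Rightarrow> real) topology" where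
  "field_topology b = Metric_space.mtopology (field_space b) (field_dist b)"


section \<open>Displacement fields\<close>

definition cutoff :: "real \<Rightarrow> nat \<Rightarrow> nat" where
  "cutoff c n = nat (min \<lfloor>c * ln (real n)\<rfloor> (int n - 1))"

definition displacement ::
  "nat \<Rightarrow> real \<Rightarrow> (nat list \<Rightarrow> 'a \<Rightarrow> real) \<Rightarrow> nat \<Rightarrow> 'a \<Rightarrow> nat list \<Rightarrow> real" where
  "displacement b c X n \<omega> v =
     (if v \<in> tree b - {[]} \<and> length v \<le> cutoff c n
      then X v \<omega> / sqrt (real (n - cutoff c n)) else 0)"

definition field_rate :: "nat \<Rightarrow> real \<Rightarrow> real \<Rightarrow> (nat list \<Rightarrow> real) \<Rightarrow> ennreal" where
  "field_rate b \<alpha> lam h =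
     ennreal lam * (\<Sum>\<^sub>\<infinity>v\<in>tree b - {[]}. ennreal (\<bar>h v\<bar> powr \<alpha>))"


section \<open>The space of fields is a normed space\<close>

lemma field_norm_nonneg: "0 \<le> field_norm b h"
  unfolding field_norm_def by (intro infsum_nonneg divide_nonneg_nonneg sum_nonneg) auto

lemma field_norm_scale: "field_norm b (\<lambda>v. c * h v) = \<bar>c\<bar> * field_norm b h"
proof -
  have "(\<Sum>v\<in>tree_level b k. \<bar>c * h v\<bar>) / real b ^ k
      = \<bar>c\<bar> * ((\<Sum>v\<in>tree_level b k. \<bar>h v\<bar>) / real b ^ k)" for k
    by (simp add: abs_mult sum_distrib_left)
  then show ?thesis
    unfolding field_norm_def by (simp only: infsum_cmult_right')
qed

lemma field_space_scale:
  assumes "h \<in> field_space b" shows "(\<lambda>v. c * h v) \<in> field_space b"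
proof -
  have "(\<Sum>v\<in>tree_level b k. \<bar>c * h v\<bar>) / real b ^ k
      = \<bar>c\<bar> * ((\<Sum>v\<in>tree_level b k. \<bar>h v\<bar>) / real b ^ k)" for k
    by (simp add: abs_mult sum_distrib_left)
  moreover have "(\<lambda>k. \<bar>c\<bar> * ((\<Sum>v\<in>tree_level b k. \<bar>h v\<bar>) / real b ^ k)) summable_on {1..}"
    using assms by (intro summable_on_cmult_right) (simp add: field_space_def)
  ultimately have "(\<lambda>k. (\<Sum>v\<in>tree_level b k. \<bar>c * h v\<bar>) / real b ^ k) summable_on {1..}"
    by (simp only:)
  with assms show ?thesis
    by (simp add: field_space_def)
qed

lemma
  assumes g: "g \<in> field_space b" and h: "h \<in> field_space b"
  shows field_space_add: "(\<lambda>v. g v + h v) \<in> field_space b"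
    and field_norm_triangle: "field_norm b (\<lambda>v. g v + h v) \<le> field_norm b g + field_norm b h"
proof -
  let ?t = "\<lambda>h k. (\<Sum>v\<in>tree_level b k. \<bar>h v\<bar>) / real b ^ k"
  have sg: "?t g summable_on {1..}" and sh: "?t h summable_on {1..}"
    using g h by (auto simp: field_space_def)
  have le: "?t (\<lambda>v. g v + h v) k \<le> ?t g k + ?t h k" for k
    unfolding add_divide_distrib[symmetric] sum.distrib[symmetric]
    by (intro divide_right_mono sum_mono) auto
  have s: "?t (\<lambda>v. g v + h v) summable_on {1..}"
    by (rule summable_on_comparison_test[OF summable_on_add[OF sg sh]])
       (auto intro!: le divide_nonneg_nonneg sum_nonneg)
  show "(\<lambda>v. g v + h v) \<in> field_space b"
    using g h s by (auto simp: field_space_def)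
  show "field_norm b (\<lambda>v. g v + h v) \<le> field_norm b g + field_norm b h"
    unfolding field_norm_def infsum_add[OF sg sh, symmetric]
    by (rule infsum_mono[OF s summable_on_add[OF sg sh] le])
qed

lemma field_norm_eq_0_iff:
  assumes b: "0 < b" and h: "h \<in> field_space b"
  shows "field_norm b h = 0 \<longleftrightarrow> h = (\<lambda>v. 0)"
proof
  let ?t = "\<lambda>k. (\<Sum>v\<in>tree_level b k. \<bar>h v\<bar>) / real b ^ k"
  assume *: "field_norm b h = 0"
  have t0: "?t k = 0" if "1 \<le> k" for k
    by (rule nonneg_infsum_le_0D[of ?t "{1..}"])
       (use * h that in \<open>auto simp: field_norm_def field_space_def
          intro!: divide_nonneg_nonneg sum_nonneg\<close>)
  have fin: "finite (tree_level b k)" for k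
    using finite_lists_length_eq[of "{1..b}" k] by (simp add: tree_level_def conj_commute)
  show "h = (\<lambda>v. 0)"
  proof
    fix v
    show "h v = 0"
    proof (cases "v \<in> tree b \<and> v \<noteq> []")
      case True
      then have v: "v \<in> tree_level b (length v)" and "1 \<le> length v"
        by (auto simp: tree_def tree_level_def Suc_le_eq)
      from t0[OF this(2)] b have "(\<Sum>v\<in>tree_level b (length v). \<bar>h v\<bar>) = 0"
        by auto
      with v show ?thesis
        using sum_nonneg_eq_0_iff[OF fin, of "length v" "\<lambda>v. \<bar>h v\<bar>"] by auto
    next
      case False
      with h show ?thesis by (auto simp: field_space_def)
    qed
  qed
qed (simp add: field_norm_def)

lemma field_space_diff:
  assumes "g \<in> field_space b" "h \<in> field_space b"
  shows "(\<lambda>v. g v - h v) \<in> field_space b"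
  using field_space_add[OF assms(1) field_space_scale[OF assms(2), of "-1"]] by simp

lemma Metric_space_field_space:
  assumes "0 < b" shows "Metric_space (field_space b) (field_dist b)"
proof
  show "0 \<le> field_dist b g h" for g h
    by (simp add: field_dist_def field_norm_nonneg)
  show "field_dist b g h = field_dist b h g" for g h
    by (simp add: field_dist_def field_norm_def abs_minus_commute)
next
  fix g h assume "g \<in> field_space b" "h \<in> field_space b"
  from field_norm_eq_0_iff[OF assms field_space_diff[OF this]]
  show "field_dist b g h = 0 \<longleftrightarrow> g = h"
    by (auto simp: field_dist_def fun_eq_iff)
next
  fix f g h assume "f \<in> field_space b" "g \<in> field_space b" "h \<in> field_space b"
  then show "field_dist b f h \<le> field_dist b f g + field_dist b g h"
    using field_norm_triangle[OF field_space_diff[of f b g] field_space_diff[of g b h]]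
    by (simp add: field_dist_def)
qed

end

theory Submission
  imports Defs "HOL-Real_Asymp.Real_Asymp"
begin

text \<open>
  Let \<open>A n = (ln n) powr (2 / \<alpha>)\<close>. Removing from \<open>Y n\<close> the sites with \<open>\<bar>X v\<bar> \<le> A n\<close> changes the
  norm by at most \<open>k n * A n / sqrt (m n)\<close>, which tends to \<open>0\<close> deterministically. For \<open>\<theta> < lam\<close>
  the energy of the remaining sites satisfies
  \<open>E exp (\<theta> * \<bar>X\<bar> powr \<alpha> * 1{\<bar>X\<bar> > A n}) \<le> 1 + C * exp (- \<delta> * (ln n)\<^sup>2)\<close>, and the product of these
  factors over the polynomially many sites stays bounded. By Markov's inequality the truncated field
  has rate above \<open>L\<close> with probability at most \<open>exp (- (\<theta> / lam) * L * m n powr (\<alpha> / 2) + O(1))\<close>.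
  Sublevel sets of the rate function are compact, hence at positive distance from any closed set
  disjoint from them, and the upper bound follows.

  For the lower bound, approximate \<open>h\<close> by a field supported on finitely many levels, let \<open>X v\<close>
  fall in a window of width of order \<open>sqrt (m n)\<close> at the finitely many sites of its support, and ask
  for \<open>\<bar>X v\<bar> \<le> A n\<close> at all other sites, which has probability tending to \<open>1\<close>.
\<close>

section \<open>Compactness in the space of fields\<close>

lemma finite_tree_level: "finite (tree_level b k)"
  using finite_lists_length_eq[of "{1..b}" k] by (simp add: tree_level_def conj_commute)

lemma card_tree_level: "card (tree_level b k) = b ^ k"
  using card_lists_length_eq[of "{1..b}" k] by (simp add: tree_level_def conj_commute)

lemma mem_tree_iff: "v \<in> tree b \<longleftrightarrow> set v \<subseteq> {1..b}"
  by (auto simp: tree_def tree_level_def)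

lemma tree_level_Suc_subset: "tree_level b (Suc k) \<subseteq> tree b - {[]}"
  by (auto simp: tree_def tree_level_def)

text \<open>This is one summand of the norm. Indexing it by \<open>Suc k\<close> turns the unordered
  sum over positive generations into an ordinary series, to which comparison, tail estimates and
  Tannery's theorem apply.\<close>

definition level_mean :: "nat \<Rightarrow> (nat list \<Rightarrow> real) \<Rightarrow> nat \<Rightarrow> real" where
  "level_mean b h k = (\<Sum>v\<in>tree_level b k. \<bar>h v\<bar>) / real b ^ k"

lemma level_mean_nonneg: "0 \<le> level_mean b h k"
  by (simp add: level_mean_def sum_nonneg)

lemma level_mean_le:
  assumes "0 < b" "\<And>v. v \<in> tree_level b k \<Longrightarrow> \<bar>h v\<bar> \<le> \<beta>"
  shows "level_mean b h k \<le> \<beta>"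
proof -
  have "(\<Sum>v\<in>tree_level b k. \<bar>h v\<bar>) \<le> real (card (tree_level b k)) * \<beta>"
    using assms(2) by (intro sum_bounded_above) auto
  then show ?thesis
    using assms(1) by (simp add: level_mean_def card_tree_level field_simps)
qed

lemma atLeast_1_eq_Suc_image: "{1::nat..} = range Suc"
  by (auto simp: image_iff Suc_le_eq gr0_conv_Suc)

lemma field_space_iff:
  "h \<in> field_space b \<longleftrightarrow>
     h [] = 0 \<and> (\<forall>v. v \<notin> tree b \<longrightarrow> h v = 0) \<and> summable (\<lambda>k. level_mean b h (Suc k))"
proof -
  have "(\<lambda>k. level_mean b h k) summable_on {1..} \<longleftrightarrow> (\<lambda>k. level_mean b h (Suc k)) summable_on UNIV"
    unfolding atLeast_1_eq_Suc_image by (subst summable_on_reindex) (auto simp: o_def)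
  also have "\<dots> \<longleftrightarrow> summable (\<lambda>k. level_mean b h (Suc k))"
    by (rule summable_on_UNIV_nonneg_real_iff) (rule level_mean_nonneg)
  finally show ?thesis
    by (simp add: field_space_def level_mean_def)
qed

lemma field_norm_sums:
  assumes "h \<in> field_space b"
  shows "(\<lambda>k. level_mean b h (Suc k)) sums field_norm b h"
proof -
  have "(\<lambda>k. level_mean b h (Suc k)) summable_on UNIV"
    using assms summable_on_UNIV_nonneg_real_iff[of "\<lambda>k. level_mean b h (Suc k)"]
    by (simp add: field_space_iff level_mean_nonneg)
  then have "(\<lambda>k. level_mean b h (Suc k)) sums (\<Sum>\<^sub>\<infinity>k. level_mean b h (Suc k))"
    by (intro has_sum_imp_sums has_sum_infsum)
  also have "(\<Sum>\<^sub>\<infinity>k. level_mean b h (Suc k)) = field_norm b h"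
    unfolding field_norm_def atLeast_1_eq_Suc_image
    by (subst infsum_reindex) (auto simp: o_def level_mean_def)
  finally show ?thesis .
qed

lemma field_norm_eq_suminf:
  assumes "h \<in> field_space b"
  shows "field_norm b h = (\<Sum>k. level_mean b h (Suc k))"
  using field_norm_sums[OF assms] by (simp add: sums_iff)

lemma level_mean_eq_0:
  assumes "\<And>v. v \<in> tree_level b k \<Longrightarrow> h v = 0"
  shows "level_mean b h k = 0"
  using assms by (simp add: level_mean_def)

lemma field_space_finite_levels:
  assumes "h [] = 0" "\<And>v. v \<notin> tree b \<Longrightarrow> h v = 0" "\<And>v. K < length v \<Longrightarrow> h v = 0"
  shows "h \<in> field_space b"
    and "field_norm b h = (\<Sum>k<K. level_mean b h (Suc k))"
proof -
  have 0: "level_mean b h (Suc k) = 0" if "k \<notin> {..<K}" for k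
    using that assms(3) by (intro level_mean_eq_0) (auto simp: tree_level_def)
  then have "(\<lambda>k. level_mean b h (Suc k)) sums (\<Sum>k<K. level_mean b h (Suc k))"
    by (intro sums_finite) auto
  then show *: "h \<in> field_space b"
    using assms by (auto simp: field_space_iff sums_iff)
  show "field_norm b h = (\<Sum>k<K. level_mean b h (Suc k))"
    using 0 by (subst field_norm_eq_suminf[OF *], intro suminf_finite) auto
qed

text \<open>An unordered sum of nonnegative terms is the supremum of its finite partial sums.
  Testing the bound on finite sets of sites keeps the arithmetic real-valued and survives sitewise
  limits.\<close>

lemma field_rate_le_iff:
  assumes "0 < lam" "0 \<le> L"
  shows "field_rate b \<alpha> lam h \<le> ennreal L \<longleftrightarrow>
    (\<forall>F. finite F \<and> F \<subseteq> tree b - {[]} \<longrightarrow> lam * (\<Sum>v\<in>F. \<bar>h v\<bar> powr \<alpha>) \<le> L)"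
proof -
  have "field_rate b \<alpha> lam h = (SUP F\<in>{F. finite F \<and> F \<subseteq> tree b - {[]}}.
      ennreal lam * (\<Sum>v\<in>F. ennreal (\<bar>h v\<bar> powr \<alpha>)))"
    unfolding field_rate_def by (subst nonneg_infsum_complete) (auto simp: SUP_mult_left_ennreal)
  also have "\<dots> = (SUP F\<in>{F. finite F \<and> F \<subseteq> tree b - {[]}}.
      ennreal (lam * (\<Sum>v\<in>F. \<bar>h v\<bar> powr \<alpha>)))"
    using assms(1) by (simp add: sum_nonneg ennreal_mult)
  finally show ?thesis
    using assms by (auto simp: SUP_le_iff)
qed

text \<open>This is the source of compactness: one summable majorant serves all fields of bounded
  energy, so the tails of their norms are uniformly small. For \<open>\<alpha> \<le> 1\<close> the
  energy already controls the plain sum over a level and the weight of the level gives geometric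
  decay; for larger \<open>\<alpha>\<close> small and large values have to be separated.\<close>

lemma level_mean_summable_bound:
  assumes b: "2 \<le> b" and \<alpha>: "0 < \<alpha>" and K: "0 \<le> K"
  obtains B where "summable B"
    "\<And>h k. (\<And>F. finite F \<Longrightarrow> F \<subseteq> tree b - {[]} \<Longrightarrow> (\<Sum>v\<in>F. \<bar>h v\<bar> powr \<alpha>) \<le> K) \<Longrightarrow>
       level_mean b h (Suc k) \<le> B k"
proof (cases "\<alpha> \<le> 1")
  case True
  \<comment> \<open>A single site has energy at most \<open>K\<close>, so \<open>C\<close> bounds
    every value of the field.\<close>
  define C where "C = K powr (1 / \<alpha>)"
  define B where "B = (\<lambda>k. C powr (1 - \<alpha>) * K * (1 / real b) ^ Suc k)"
  have "summable (\<lambda>k. (1 / real b) ^ Suc k)"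
    using b by (simp only: summable_Suc_iff) (rule summable_geometric, simp)
  then have "summable B"
    unfolding B_def by (rule summable_mult)
  moreover have "level_mean b h (Suc k) \<le> B k"
    if h: "\<And>F. finite F \<Longrightarrow> F \<subseteq> tree b - {[]} \<Longrightarrow> (\<Sum>v\<in>F. \<bar>h v\<bar> powr \<alpha>) \<le> K" for h k
  proof -
    let ?T = "tree_level b (Suc k)"
    have *: "\<bar>h v\<bar> \<le> C powr (1 - \<alpha>) * \<bar>h v\<bar> powr \<alpha>" if v: "v \<in> ?T" for v
    proof (cases "h v = 0")
      case False
      have "\<bar>h v\<bar> powr \<alpha> \<le> K"
        using h[of "{v}"] v tree_level_Suc_subset by auto
      then have "(\<bar>h v\<bar> powr \<alpha>) powr (1 / \<alpha>) \<le> C"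
        unfolding C_def using \<alpha> by (intro powr_mono2) auto
      then have C: "\<bar>h v\<bar> \<le> C"
        using \<alpha> False by (simp add: powr_powr)
      have "\<bar>h v\<bar> = \<bar>h v\<bar> powr (1 - \<alpha>) * \<bar>h v\<bar> powr \<alpha>"
        using False by (simp add: powr_add[symmetric])
      also have "\<dots> \<le> C powr (1 - \<alpha>) * \<bar>h v\<bar> powr \<alpha>"
        using C True by (intro mult_right_mono powr_mono2) auto
      finally show ?thesis .
    qed simp
    have "(\<Sum>v\<in>?T. \<bar>h v\<bar>) \<le> (\<Sum>v\<in>?T. C powr (1 - \<alpha>) * \<bar>h v\<bar> powr \<alpha>)"
      by (rule sum_mono) (rule *)
    also have "\<dots> \<le> C powr (1 - \<alpha>) * K"
      unfolding sum_distrib_left[symmetric]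
      by (intro mult_left_mono h finite_tree_level tree_level_Suc_subset) auto
    finally have "level_mean b h (Suc k) \<le> C powr (1 - \<alpha>) * K / real b ^ Suc k"
      unfolding level_mean_def by (intro divide_right_mono) auto
    then show ?thesis
      by (simp add: B_def power_divide)
  qed
  ultimately show ?thesis
    by (rule that)
next
  case False
  \<comment> \<open>On level \<open>k\<close> use \<open>\<bar>x\<bar> \<le> s + s powr (1 - \<alpha>) * \<bar>x\<bar> powr \<alpha>\<close> with \<open>s = q ^ k\<close>; this \<open>q\<close>
    balances the two contributions to the level mean.\<close>
  define q where "q = real b powr (- 1 / \<alpha>)"
  have q: "0 < q" "q < 1"
    using b \<alpha> by (auto simp: q_def intro!: powr_less_one)
  define B where "B = (\<lambda>k. (1 + K) * q ^ Suc k)"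
  have "summable (\<lambda>k. q ^ Suc k)"
    using q by (simp only: summable_Suc_iff) (rule summable_geometric, simp)
  then have "summable B"
    unfolding B_def by (rule summable_mult)
  moreover have "level_mean b h (Suc k) \<le> B k"
    if h: "\<And>F. finite F \<Longrightarrow> F \<subseteq> tree b - {[]} \<Longrightarrow> (\<Sum>v\<in>F. \<bar>h v\<bar> powr \<alpha>) \<le> K" for h k
  proof -
    let ?T = "tree_level b (Suc k)" and ?s = "q ^ Suc k"
    have s: "0 < ?s"
      using q by simp
    have s_eq: "?s = real b powr (- real (Suc k) / \<alpha>)"
    proof -
      have "?s = q powr real (Suc k)"
        using q by (simp only: powr_realpow)
      also have "\<dots> = real b powr (- 1 / \<alpha> * real (Suc k))"
        by (simp only: q_def powr_powr)
      also have "- 1 / \<alpha> * real (Suc k) = - real (Suc k) / \<alpha>"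
        using \<alpha> by (simp add: field_simps)
      finally show ?thesis .
    qed
    have *: "\<bar>h v\<bar> \<le> ?s + ?s powr (1 - \<alpha>) * \<bar>h v\<bar> powr \<alpha>" for v
    proof (cases "\<bar>h v\<bar> \<le> ?s")
      case True
      then show ?thesis
        by (smt (verit) mult_nonneg_nonneg powr_ge_zero)
    next
      case gt: False
      then have "h v \<noteq> 0"
        using s by auto
      then have "\<bar>h v\<bar> = \<bar>h v\<bar> powr (1 - \<alpha>) * \<bar>h v\<bar> powr \<alpha>"
        by (simp add: powr_add[symmetric])
      \<comment> \<open>For \<open>1 < \<alpha>\<close> the power with exponent
        \<open>1 - \<alpha>\<close> is decreasing, so it may be evaluated at the smaller point
        \<open>?s\<close>.\<close>
      also have "\<dots> \<le> ?s powr (1 - \<alpha>) * \<bar>h v\<bar> powr \<alpha>"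
        using gt False s by (intro mult_right_mono powr_mono2') auto
      finally show ?thesis
        using s by linarith
    qed
    have "(\<Sum>v\<in>?T. \<bar>h v\<bar>) \<le> (\<Sum>v\<in>?T. ?s + ?s powr (1 - \<alpha>) * \<bar>h v\<bar> powr \<alpha>)"
      by (rule sum_mono) (rule *)
    also have "\<dots> = real b ^ Suc k * ?s + ?s powr (1 - \<alpha>) * (\<Sum>v\<in>?T. \<bar>h v\<bar> powr \<alpha>)"
      by (simp only: sum.distrib sum_constant card_tree_level sum_distrib_left of_nat_power)
    also have "\<dots> \<le> real b ^ Suc k * ?s + ?s powr (1 - \<alpha>) * K"
      by (intro add_left_mono mult_left_mono h finite_tree_level tree_level_Suc_subset) auto
    finally have "level_mean b h (Suc k) \<le> (real b ^ Suc k * ?s + ?s powr (1 - \<alpha>) * K) / real b ^ Suc k"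
      unfolding level_mean_def by (intro divide_right_mono) auto
    also have "\<dots> = ?s + ?s powr (1 - \<alpha>) / real b ^ Suc k * K"
      using b by (simp add: add_divide_distrib)
    \<comment> \<open>By the choice of \<open>q\<close> the quotient of the two powers is again
      \<open>?s\<close>, so both contributions are multiples of \<open>?s\<close>.\<close>
    also have "real b ^ Suc k = ?s powr (- \<alpha>)"
      unfolding s_eq powr_powr using b \<alpha> by (subst powr_realpow[symmetric]) (auto simp: add.commute)
    also have "?s powr (1 - \<alpha>) / ?s powr (- \<alpha>) = ?s"
      using s by (simp only: powr_diff[symmetric]) simp
    finally show ?thesis
      by (simp add: B_def algebra_simps)
  qed
  ultimately show ?thesis
    by (rule that)
qed


text \<open>Tychonoff's theorem for a cube replaces the diagonal argument; with countably many
  coordinates compactness gives sequential compactness.\<close>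

lemma bounded_pointwise_convergent_subseq:
  fixes \<sigma> :: "nat \<Rightarrow> 'i::countable \<Rightarrow> real"
  assumes "\<And>n i. \<bar>\<sigma> n i\<bar> \<le> C"
  obtains l r where "strict_mono r" "\<And>i. (\<lambda>n. \<sigma> (r n) i) \<longlonglongrightarrow> l i"
proof -
  have "compactin (product_topology (\<lambda>_::'i. euclideanreal) UNIV) (PiE UNIV (\<lambda>_. {-C..C}))"
    by (subst compactin_PiE) auto
  then have "compact (PiE UNIV (\<lambda>_::'i. {-C..C}))"
    by (simp add: euclidean_product_topology)
  then have "seq_compact (PiE UNIV (\<lambda>_::'i. {-C..C}))"
    by (rule compact_imp_seq_compact)
  moreover have "\<sigma> n \<in> PiE UNIV (\<lambda>_. {-C..C})" for n
    using assms[of n] by (auto simp: abs_le_iff minus_le_iff)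
  ultimately obtain l r where r: "strict_mono r" "(\<sigma> \<circ> r) \<longlonglongrightarrow> l"
    by (blast elim: seq_compactE)
  have "(\<lambda>n. \<sigma> (r n) i) \<longlonglongrightarrow> l i" for i
    using r(2) continuous_on_tendsto_compose[OF continuous_on_product_coordinates[of i] r(2)]
    by (auto simp: o_def)
  with r(1) show ?thesis
    by (rule that)
qed

section \<open>Compact sublevel sets, separation from closed sets, approximation\<close>

lemma topspace_field_topology: "0 < b \<Longrightarrow> topspace (field_topology b) = field_space b"
  unfolding field_topology_def by (rule Metric_space.topspace_mtopology[OF Metric_space_field_space])

text \<open>Bounded energy bounds each site, so a subsequence converges sitewise. Energies over
  finite sets of sites are continuous in the site values, hence the limit stays in the sublevel set;
  the common majorant of the level means upgrades sitewise convergence to convergence in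
  norm.\<close>

lemma compactin_field_rate_sublevel:
  assumes b: "2 \<le> b" and \<alpha>: "0 < \<alpha>" and lam: "0 < lam" and L: "0 \<le> L"
  shows "compactin (field_topology b) {h \<in> field_space b. field_rate b \<alpha> lam h \<le> ennreal L}"
proof -
  interpret Metric_space "field_space b" "field_dist b"
    using b by (intro Metric_space_field_space) simp
  let ?S = "{h \<in> field_space b. field_rate b \<alpha> lam h \<le> ennreal L}"
  define K where "K = L / lam"
  have K: "0 \<le> K"
    using lam L by (simp add: K_def)
  have le_iff: "field_rate b \<alpha> lam h \<le> ennreal L \<longleftrightarrow>
      (\<forall>F. finite F \<and> F \<subseteq> tree b - {[]} \<longrightarrow> (\<Sum>v\<in>F. \<bar>h v\<bar> powr \<alpha>) \<le> K)" for h
    using lam L by (simp add: field_rate_le_iff K_def field_simps)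
  obtain B where B: "summable B"
    "\<And>h k. (\<And>F. finite F \<Longrightarrow> F \<subseteq> tree b - {[]} \<Longrightarrow> (\<Sum>v\<in>F. \<bar>h v\<bar> powr \<alpha>) \<le> K) \<Longrightarrow>
       level_mean b h (Suc k) \<le> B k"
    using level_mean_summable_bound[OF b \<alpha> K] by blast
  have bound: "\<bar>h v\<bar> \<le> K powr (1 / \<alpha>)" if h: "h \<in> ?S" for h v
  proof (cases "v \<in> tree b - {[]}")
    case True
    have "\<forall>F. finite F \<and> F \<subseteq> tree b - {[]} \<longrightarrow> (\<Sum>v\<in>F. \<bar>h v\<bar> powr \<alpha>) \<le> K"
      using h le_iff[of h] by simp
    from this[rule_format, of "{v}"] True have "\<bar>h v\<bar> powr \<alpha> \<le> K"
      by simp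
    then have "(\<bar>h v\<bar> powr \<alpha>) powr (1 / \<alpha>) \<le> K powr (1 / \<alpha>)"
      using \<alpha> by (intro powr_mono2) auto
    then show ?thesis
      using \<alpha> by (simp add: powr_powr)
  qed (use h in \<open>auto simp: field_space_def\<close>)
  have "\<exists>l r. l \<in> ?S \<and> strict_mono r \<and> limitin mtopology (\<sigma> \<circ> r) l sequentially"
    if \<sigma>: "range \<sigma> \<subseteq> ?S" for \<sigma> :: "nat \<Rightarrow> nat list \<Rightarrow> real"
  proof -
    have \<sigma>S: "\<sigma> n \<in> ?S" for n
      using \<sigma> by auto
    obtain l r where r: "strict_mono r" and l: "\<And>v. (\<lambda>n. \<sigma> (r n) v) \<longlonglongrightarrow> l v"
      using bounded_pointwise_convergent_subseq[of \<sigma>, OF bound[OF \<sigma>S]] by blast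
    have \<sigma>_le: "(\<Sum>v\<in>F. \<bar>\<sigma> n v\<bar> powr \<alpha>) \<le> K" if "finite F" "F \<subseteq> tree b - {[]}" for n F
      using \<sigma>S[of n] that le_iff[of "\<sigma> n"] by auto
    have l_le: "(\<Sum>v\<in>F. \<bar>l v\<bar> powr \<alpha>) \<le> K" if F: "finite F" "F \<subseteq> tree b - {[]}" for F
    proof (rule LIMSEQ_le_const2)
      show "(\<lambda>n. \<Sum>v\<in>F. \<bar>\<sigma> (r n) v\<bar> powr \<alpha>) \<longlonglongrightarrow> (\<Sum>v\<in>F. \<bar>l v\<bar> powr \<alpha>)"
        using \<alpha> by (intro tendsto_sum tendsto_powr' tendsto_rabs l tendsto_const) auto
      show "\<exists>N. \<forall>n\<ge>N. (\<Sum>v\<in>F. \<bar>\<sigma> (r n) v\<bar> powr \<alpha>) \<le> K"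
        using \<sigma>_le F by blast
    qed
    have zero: "l v = 0" if "v = [] \<or> v \<notin> tree b" for v
    proof -
      have "\<sigma> (r n) v = 0" for n
        using \<sigma>S[of "r n"] that by (auto simp: field_space_def)
      then have "(\<lambda>n. \<sigma> (r n) v) \<longlonglongrightarrow> 0"
        by simp
      then show ?thesis
        by (rule LIMSEQ_unique[OF l])
    qed
    have mean_l: "level_mean b l (Suc k) \<le> B k" for k
      using l_le by (intro B(2))
    have mean_\<sigma>: "level_mean b (\<sigma> n) (Suc k) \<le> B k" for n k
      using \<sigma>_le by (intro B(2))
    have "summable (\<lambda>k. level_mean b l (Suc k))"
      by (rule summable_comparison_test'[OF B(1)]) (simp add: mean_l level_mean_nonneg)
    then have l_space: "l \<in> field_space b"
      using zero by (simp add: field_space_iff)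
    then have l_S: "l \<in> ?S"
      using le_iff[of l] l_le by auto
    \<comment> \<open>Each level is finite, so its mean tends to 0, and \<open>2 * B k\<close>
      dominates all the means. Tannery's theorem exchanges limit and series.\<close>
    have "(\<lambda>n. \<Sum>k. level_mean b (\<lambda>v. \<sigma> (r n) v - l v) (Suc k)) \<longlonglongrightarrow> (\<Sum>k::nat. 0)"
    proof (rule tannerys_theorem[THEN conjunct2, THEN conjunct2])
      show "(\<lambda>n. level_mean b (\<lambda>v. \<sigma> (r n) v - l v) (Suc k)) \<longlonglongrightarrow> 0" for k
      proof -
        have "(\<lambda>n. level_mean b (\<lambda>v. \<sigma> (r n) v - l v) (Suc k))
            \<longlonglongrightarrow> (\<Sum>v\<in>tree_level b (Suc k). \<bar>l v - l v\<bar>) / real b ^ Suc k"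
          unfolding level_mean_def using b
          by (intro tendsto_divide tendsto_sum tendsto_rabs tendsto_diff l tendsto_const) auto
        then show ?thesis
          by simp
      qed
      have "norm (level_mean b (\<lambda>v. \<sigma> (r n) v - l v) (Suc k)) \<le> 2 * B k" for n k
      proof -
        have "level_mean b (\<lambda>v. \<sigma> (r n) v - l v) (Suc k)
            \<le> level_mean b (\<sigma> (r n)) (Suc k) + level_mean b l (Suc k)"
          unfolding level_mean_def add_divide_distrib[symmetric] sum.distrib[symmetric]
          by (intro divide_right_mono sum_mono) auto
        then show ?thesis
          using mean_l[of k] mean_\<sigma>[of "r n" k] by (simp add: level_mean_nonneg)
      qed
      then show "\<forall>\<^sub>F (k, n) in at_top \<times>\<^sub>F sequentially.
          norm (level_mean b (\<lambda>v. \<sigma> (r n) v - l v) (Suc k)) \<le> 2 * B k"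
        by (intro always_eventually) auto
      show "summable (\<lambda>k. 2 * B k)"
        using B(1) by (rule summable_mult)
    qed auto
    moreover have "field_dist b (\<sigma> (r n)) l = (\<Sum>k. level_mean b (\<lambda>v. \<sigma> (r n) v - l v) (Suc k))" for n
      unfolding field_dist_def using \<sigma>S[of "r n"] l_space
      by (intro field_norm_eq_suminf field_space_diff) auto
    ultimately have "(\<lambda>n. field_dist b (\<sigma> (r n)) l) \<longlonglongrightarrow> 0"
      by simp
    then have "limitin mtopology (\<sigma> \<circ> r) l sequentially"
      unfolding limitin_metric_dist_null using l_space \<sigma>S by auto
    with l_S r show ?thesis
      by blast
  qed
  then show ?thesis
    unfolding field_topology_def compactin_sequentially by blast
qed

text \<open>Lower semicontinuity follows from compactness: in a metric space compact sublevel sets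
  are closed. The level \<open>\<infinity>\<close> is left over and has an empty strict superlevel
  set.\<close>

lemma good_rate_function_field_rate:
  assumes b: "2 \<le> b" and \<alpha>: "0 < \<alpha>" and lam: "0 < lam"
  shows "good_rate_function (field_topology b) (field_rate b \<alpha> lam)"
proof -
  have top: "topspace (field_topology b) = field_space b"
    using b by (intro topspace_field_topology) simp
  have compact: "compactin (field_topology b) {h \<in> field_space b. field_rate b \<alpha> lam h \<le> ennreal L}"
    if "0 \<le> L" for L
    using assms that by (rule compactin_field_rate_sublevel)
  have "openin (field_topology b) {h \<in> field_space b. a < field_rate b \<alpha> lam h}" for a
  proof (cases a rule: ennreal_cases)
    case (real L)
    have "closedin (field_topology b) {h \<in> field_space b. field_rate b \<alpha> lam h \<le> a}"
      unfolding real(2) using b compact[OF real(1)]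
      by (intro compactin_imp_closedin)
        (auto simp: field_topology_def intro!: Metric_space.Hausdorff_space_mtopology
          Metric_space_field_space)
    then have "openin (field_topology b)
        (field_space b - {h \<in> field_space b. field_rate b \<alpha> lam h \<le> a})"
      unfolding top[symmetric] by (rule openin_diff[OF openin_topspace])
    also have "field_space b - {h \<in> field_space b. field_rate b \<alpha> lam h \<le> a}
        = {h \<in> field_space b. a < field_rate b \<alpha> lam h}"
      by auto
    finally show ?thesis .
  qed simp
  then show ?thesis
    using compact by (auto simp: good_rate_function_def rate_function_def top)
qed

text \<open>Take a Lebesgue number of the cover of \<open>K\<close> by the single open set
  complementary to \<open>C\<close>. The gap must be uniform over \<open>K\<close>, because later
  the nearby point of the sublevel set varies with \<open>\<omega>\<close> and
  \<open>n\<close>.\<close>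

lemma compactin_closedin_field_dist_gap:
  assumes b: "0 < b"
    and K: "compactin (field_topology b) K" and C: "closedin (field_topology b) C"
    and disj: "K \<inter> C = {}"
  obtains \<delta> where "0 < \<delta>" "\<And>g h. g \<in> K \<Longrightarrow> h \<in> C \<Longrightarrow> \<delta> \<le> field_dist b g h"
proof -
  interpret Metric_space "field_space b" "field_dist b"
    using b by (rule Metric_space_field_space)
  have sub: "K \<subseteq> field_space b" "C \<subseteq> field_space b"
    using compactin_subset_topspace[OF K] closedin_subset[OF C] b
    by (simp_all add: topspace_field_topology)
  obtain \<delta> where "0 < \<delta>" and \<delta>: "\<forall>x\<in>K. \<exists>U\<in>{field_space b - C}. mball x \<delta> \<subseteq> U"
    using lebesgue_number[of K "{field_space b - C}"] K C disj sub b
    by (auto simp: field_topology_def closedin_def)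
  have "\<delta> \<le> field_dist b g h" if "g \<in> K" "h \<in> C" for g h
  proof (rule ccontr)
    assume "\<not> \<delta> \<le> field_dist b g h"
    then have "h \<in> mball g \<delta>"
      using that sub by (auto simp: in_mball)
    then show False
      using \<delta> that by blast
  qed
  with \<open>0 < \<delta>\<close> show ?thesis
    by (rule that)
qed

text \<open>The removed part contributes exactly a tail of the convergent norm series. The lower
  bound uses this to reduce to fields living on finitely many sites.\<close>

lemma field_space_truncation:
  assumes h: "h \<in> field_space b" and \<rho>: "0 < \<rho>"
  obtains K where "field_norm b (\<lambda>v. h v - (if length v \<le> K then h v else 0)) < \<rho>"
proof -
  let ?m = "\<lambda>k. level_mean b h (Suc k)"
  have sm: "summable ?m"
    using h by (simp add: field_space_iff)
  then obtain K where K: "norm (\<Sum>k. ?m (k + K)) < \<rho>"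
    using suminf_exist_split[OF \<rho>] by blast
  let ?g = "\<lambda>v. if length v \<le> K then h v else 0"
  have g: "?g \<in> field_space b"
    using h by (intro field_space_finite_levels(1)[of _ _ K]) (auto simp: field_space_def)
  let ?d = "\<lambda>k. level_mean b (\<lambda>v. h v - ?g v) (Suc k)"
  have d: "(\<lambda>v. h v - ?g v) \<in> field_space b"
    using h g by (rule field_space_diff)
  then have sd: "summable ?d"
    by (simp add: field_space_iff)
  have small: "?d k = 0" if "k < K" for k
    using that by (intro level_mean_eq_0) (auto simp: tree_level_def)
  have large: "?d (k + K) = ?m (k + K)" for k
    unfolding level_mean_def by (intro arg_cong2[where f = "(/)"] sum.cong) (auto simp: tree_level_def)
  have "field_norm b (\<lambda>v. h v - ?g v) = (\<Sum>k. ?d (k + K)) + (\<Sum>k<K. ?d k)"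
    unfolding field_norm_eq_suminf[OF d] by (rule suminf_split_initial_segment[OF sd])
  also have "\<dots> = (\<Sum>k. ?m (k + K))"
    by (simp add: small large)
  also have "\<dots> < \<rho>"
    using K by simp
  finally show ?thesis
    by (rule that)
qed

section \<open>Symmetric laws with Weibull tails\<close>

locale weibull_law = real_distribution \<mu> for \<mu> :: "real measure" +
  fixes \<alpha> lam :: real
  assumes alpha_pos: "0 < \<alpha>" and lam_pos: "0 < lam"
    and symmetric: "distr \<mu> borel uminus = \<mu>"
    and tail: "((\<lambda>x. ereal (x powr (- \<alpha>)) * ext_ln (measure \<mu> {x<..})) \<longlongrightarrow> ereal (- lam)) at_top"
begin

section \<open>Tail and window estimates for one displacement\<close>

lemma measure_uminus_vimage:
  assumes "B \<in> sets borel"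
  shows "measure \<mu> (uminus -` B) = measure \<mu> B"
proof -
  have "measure (distr \<mu> borel uminus) B = measure \<mu> (uminus -` B \<inter> space \<mu>)"
    using assms by (intro measure_distr) auto
  then show ?thesis
    by (simp add: symmetric)
qed

lemma eventually_tail_ge:
  assumes "0 < \<eta>"
  shows "\<forall>\<^sub>F t in at_top. exp (- (lam + \<eta>) * t powr \<alpha>) \<le> measure \<mu> {t<..}"
proof -
  have "\<forall>\<^sub>F t in at_top. ereal (- (lam + \<eta>)) < ereal (t powr (- \<alpha>)) * ext_ln (measure \<mu> {t<..})"
    using assms by (intro order_tendstoD(1)[OF tail]) simp
  with eventually_gt_at_top[of 0] show ?thesis
  proof eventually_elim
    case (elim t)
    let ?p = "measure \<mu> {t<..}"
    \<comment> \<open>Probability zero would make \<open>ext_ln\<close> equal to minus infinity,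
      against the strict lower bound; only then may \<open>ln\<close> be used.\<close>
    have p: "0 < ?p"
    proof (rule ccontr)
      assume "\<not> 0 < ?p"
      then show False
        using elim by (simp add: ext_ln_def)
    qed
    then have "- (lam + \<eta>) < t powr (- \<alpha>) * ln ?p"
      using elim by (simp add: ext_ln_def)
    then have "- (lam + \<eta>) * t powr \<alpha> < ln ?p"
      using elim by (simp add: powr_minus field_simps)
    then have "exp (- (lam + \<eta>) * t powr \<alpha>) < exp (ln ?p)"
      by (simp only: exp_less_cancel_iff)
    with p show ?case
      by simp
  qed
qed

lemma eventually_tail_le:
  assumes "0 < \<eta>"
  shows "\<forall>\<^sub>F t in at_top. measure \<mu> {t<..} \<le> exp (- (lam - \<eta>) * t powr \<alpha>)"
proof -
  have "\<forall>\<^sub>F t in at_top. ereal (t powr (- \<alpha>)) * ext_ln (measure \<mu> {t<..}) < ereal (- (lam - \<eta>))"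
    using assms by (intro order_tendstoD(2)[OF tail]) simp
  with eventually_gt_at_top[of 0] show ?thesis
  proof eventually_elim
    case (elim t)
    let ?p = "measure \<mu> {t<..}"
    show ?case
    proof (cases "0 < ?p")
      case True
      then have "t powr (- \<alpha>) * ln ?p < - (lam - \<eta>)"
        using elim by (simp add: ext_ln_def)
      then have "ln ?p < - (lam - \<eta>) * t powr \<alpha>"
        using elim by (simp add: powr_minus field_simps)
      then have "exp (ln ?p) < exp (- (lam - \<eta>) * t powr \<alpha>)"
        by (simp only: exp_less_cancel_iff)
      with True show ?thesis
        by simp
    qed (smt (verit) exp_gt_zero)
  qed
qed

text \<open>The window is a difference of two tails. The far endpoint has the strictly larger rate,
  so for large \<open>t\<close> its tail is at most half of the lower bound for the near one; this
  is the factor 2.\<close>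

lemma eventually_window_ge:
  assumes x: "0 < x" and \<epsilon>: "0 < \<epsilon>" and \<eta>: "0 < \<eta>"
  shows "\<forall>\<^sub>F t in at_top. exp (- (lam + \<eta>) * (x * t) powr \<alpha>) / 2 \<le> measure \<mu> {x * t<..(x + \<epsilon>) * t}"
proof -
  let ?a = "x powr \<alpha>" and ?c = "(x + \<epsilon>) powr \<alpha>"
  have ac: "0 < ?a" "?a < ?c"
    using x \<epsilon> alpha_pos by (auto intro!: powr_less_mono2)
  \<comment> \<open>The exponents stay separated if
    \<open>\<delta> * (?c + ?a) < lam * (?c - ?a)\<close>; half of the critical value leaves the
    strictly positive gap \<open>?\<kappa>\<close>.\<close>
  define \<delta> where "\<delta> = min \<eta> (lam * (?c - ?a) / (2 * (?c + ?a)))"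
  have "0 < lam * (?c - ?a) / (2 * (?c + ?a))"
    using ac lam_pos by (intro divide_pos_pos mult_pos_pos add_pos_pos) auto
  then have \<delta>: "0 < \<delta>" "\<delta> \<le> \<eta>"
    using \<eta> by (auto simp: \<delta>_def)
  have "\<delta> * (?c + ?a) \<le> lam * (?c - ?a) / (2 * (?c + ?a)) * (?c + ?a)"
    using ac by (intro mult_right_mono) (auto simp: \<delta>_def)
  also have "\<dots> = lam * (?c - ?a) / 2"
  proof -
    have "y / (2 * z) * z = y / 2" if "0 < z" for y z :: real
      using that by simp
    from this[of "?c + ?a"] ac show ?thesis
      by simp
  qed
  also have "\<dots> < lam * (?c - ?a)"
    using ac lam_pos by simp
  finally have \<kappa>: "0 < (lam - \<delta>) * ?c - (lam + \<delta>) * ?a" (is "0 < ?\<kappa>")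
    by (simp add: algebra_simps)
  have scale: "filterlim (\<lambda>t. y * t) at_top at_top" if "0 < y" for y :: real
    using that by (simp add: filterlim_tendsto_pos_mult_at_top[OF tendsto_const] filterlim_ident)
  have "filterlim (\<lambda>t. ?\<kappa> * t powr \<alpha>) at_top at_top"
    using \<kappa> alpha_pos by real_asymp
  then have "\<forall>\<^sub>F t in at_top. ln 2 \<le> ?\<kappa> * t powr \<alpha>"
    by (simp add: filterlim_at_top)
  moreover have "\<forall>\<^sub>F t in at_top. exp (- (lam + \<delta>) * (x * t) powr \<alpha>) \<le> measure \<mu> {x * t<..}"
    using eventually_compose_filterlim[OF eventually_tail_ge[OF \<delta>(1)] scale[OF x]] .
  moreover have "\<forall>\<^sub>F t in at_top. measure \<mu> {(x + \<epsilon>) * t<..} \<le> exp (- (lam - \<delta>) * ((x + \<epsilon>) * t) powr \<alpha>)"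
    using eventually_compose_filterlim[OF eventually_tail_le[OF \<delta>(1)] scale[of "x + \<epsilon>"]] x \<epsilon> by simp
  ultimately show ?thesis
    using eventually_gt_at_top[of 0]
  proof eventually_elim
    case (elim t)
    define s where "s = t powr \<alpha>"
    have pw: "(x * t) powr \<alpha> = ?a * s" "((x + \<epsilon>) * t) powr \<alpha> = ?c * s"
      using elim x \<epsilon> by (auto simp: s_def powr_mult)
    have "{x * t<..(x + \<epsilon>) * t} = {x * t<..} - {(x + \<epsilon>) * t<..}"
      by auto
    then have "measure \<mu> {x * t<..(x + \<epsilon>) * t} = measure \<mu> {x * t<..} - measure \<mu> {(x + \<epsilon>) * t<..}"
      using elim \<epsilon> by (simp only:) (intro finite_measure_Diff, auto simp: mult_right_mono)
    then have ge: "exp (- (lam + \<delta>) * (?a * s)) - exp (- (lam - \<delta>) * (?c * s))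
        \<le> measure \<mu> {x * t<..(x + \<epsilon>) * t}"
      using elim by (simp add: pw)
    have "- (lam - \<delta>) * (?c * s) \<le> - (lam + \<delta>) * (?a * s) - ln 2"
      using elim(1) by (simp add: s_def algebra_simps)
    then have "exp (- (lam - \<delta>) * (?c * s)) \<le> exp (- (lam + \<delta>) * (?a * s) - ln 2)"
      by (simp only: exp_le_cancel_iff)
    also have "\<dots> = exp (- (lam + \<delta>) * (?a * s)) / 2"
      by (simp add: exp_diff)
    finally have "exp (- (lam + \<delta>) * (?a * s)) / 2 \<le> measure \<mu> {x * t<..(x + \<epsilon>) * t}"
      using ge by linarith
    moreover have "- (lam + \<eta>) * (?a * s) \<le> - (lam + \<delta>) * (?a * s)"
      using \<delta> ac by (intro mult_right_mono) (auto simp: s_def)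
    then have "exp (- (lam + \<eta>) * (?a * s)) / 2 \<le> exp (- (lam + \<delta>) * (?a * s)) / 2"
      by simp
    ultimately show ?case
      unfolding pw by linarith
  qed
qed

section \<open>Exponential moments of one displacement\<close>

lemma measure_abs_gt_le: "measure \<mu> {x. t < \<bar>x\<bar>} \<le> 2 * measure \<mu> {t<..}"
proof -
  have "uminus -` {t<..} = {..<- t}"
    by auto
  then have "measure \<mu> {..<- t} = measure \<mu> {t<..}"
    using measure_uminus_vimage[of "{t<..}"] by simp
  moreover have "measure \<mu> {x. t < \<bar>x\<bar>} \<le> measure \<mu> ({t<..} \<union> {..<- t})"
    by (intro finite_measure_mono) auto
  moreover have "measure \<mu> ({t<..} \<union> {..<- t}) \<le> measure \<mu> {t<..} + measure \<mu> {..<- t}"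
    by (intro measure_Un_le) auto
  ultimately show ?thesis
    by linarith
qed

text \<open>An exponent \<open>\<theta>'\<close> strictly between \<open>\<theta>\<close> and
  \<open>lam\<close> still governs the tail, and the difference of the exponents makes the sum over
  integer levels geometric.\<close>

lemma exp_moment_finite:
  assumes \<theta>: "0 \<le> \<theta>" "\<theta> < lam"
  shows "(\<integral>\<^sup>+ x. ennreal (exp (\<theta> * \<bar>x\<bar> powr \<alpha>)) \<partial>\<mu>) < \<infinity>"
proof -
  define \<theta>' where "\<theta>' = (\<theta> + lam) / 2"
  have \<theta>': "\<theta> < \<theta>'" "\<theta>' < lam"
    using \<theta> by (auto simp: \<theta>'_def)
  obtain T where T: "\<And>t. T \<le> t \<Longrightarrow> measure \<mu> {t<..} \<le> exp (- \<theta>' * t powr \<alpha>)"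
    using eventually_tail_le[of "lam - \<theta>'"] \<theta>' by (auto simp: eventually_at_top_linorder)
  \<comment> \<open>From level \<open>J\<close> on, the point
    \<open>real j powr (1 / \<alpha>)\<close> lies beyond \<open>T\<close>, where the tail estimate
    is available.\<close>
  obtain J :: nat where J: "max T 0 powr \<alpha> \<le> real J"
    using real_arch_simple by blast
  have tail_J: "measure \<mu> {x. real j < \<bar>x\<bar> powr \<alpha>} \<le> 2 * exp (- \<theta>' * real j)" if "J \<le> j" for j
  proof -
    let ?t = "real j powr (1 / \<alpha>)"
    have "max T 0 = (max T 0 powr \<alpha>) powr (1 / \<alpha>)"
      using alpha_pos by (simp add: powr_powr)
    also have "\<dots> \<le> ?t"
      using J that alpha_pos by (intro powr_mono2) auto
    finally have t: "T \<le> ?t"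
      by simp
    have "?t < \<bar>x\<bar>" if "real j < \<bar>x\<bar> powr \<alpha>" for x
    proof -
      have "?t < (\<bar>x\<bar> powr \<alpha>) powr (1 / \<alpha>)"
        using that alpha_pos by (intro powr_less_mono2) auto
      then show ?thesis
        using alpha_pos by (simp add: powr_powr)
    qed
    then have "measure \<mu> {x. real j < \<bar>x\<bar> powr \<alpha>} \<le> measure \<mu> {x. ?t < \<bar>x\<bar>}"
      by (intro finite_measure_mono) auto
    also have "\<dots> \<le> 2 * measure \<mu> {?t<..}"
      by (rule measure_abs_gt_le)
    also have "\<dots> \<le> 2 * exp (- \<theta>' * ?t powr \<alpha>)"
      using T[OF t] by simp
    also have "?t powr \<alpha> = real j"
      using alpha_pos by (simp add: powr_powr)
    finally show ?thesis .
  qed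
  \<comment> \<open>Layer-cake decomposition of \<open>\<bar>x\<bar> powr \<alpha>\<close> along the integers above \<open>J\<close>.\<close>
  let ?w = "\<lambda>i. exp (\<theta> * (real (i + J) + 1))"
  let ?E = "\<lambda>i. {x. real (i + J) < \<bar>x\<bar> powr \<alpha>}"
  have pw: "ennreal (exp (\<theta> * \<bar>x\<bar> powr \<alpha>))
      \<le> ennreal (?w 0) + (\<Sum>i. ennreal (?w i) * indicator (?E i) x)" for x
  proof (cases "\<bar>x\<bar> powr \<alpha> \<le> real J + 1")
    case True
    then have "ennreal (exp (\<theta> * \<bar>x\<bar> powr \<alpha>)) \<le> ennreal (?w 0)"
      using \<theta> by (intro ennreal_leI) (auto intro: mult_left_mono)
    then show ?thesis
      by (rule order_trans) simp
  next
    case False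
    let ?z = "\<bar>x\<bar> powr \<alpha>"
    \<comment> \<open>With this index \<open>?z\<close> lies in the interval from
      \<open>i + J\<close> (excluded) to \<open>i + J + 1\<close> (included), matching the strict
      inequality in \<open>?E\<close>; this single summand already dominates.\<close>
    define i where "i = nat (\<lceil>?z\<rceil> - 1) - J"
    have i: "real (i + J) = of_int (\<lceil>?z\<rceil> - 1)"
      using False by (simp add: i_def) linarith
    define f where "f = (\<lambda>i. ennreal (?w i) * indicator (?E i) x)"
    have "ennreal (exp (\<theta> * ?z)) \<le> f i"
    proof -
      have "real (i + J) < ?z" "?z \<le> real (i + J) + 1"
        unfolding i by linarith+
      then show ?thesis
        using \<theta> by (auto simp: f_def intro!: ennreal_leI mult_left_mono)
    qed
    also have "\<dots> \<le> suminf f"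
      using sum_le_suminf[OF summableI, of "{i}" f] by simp
    finally show ?thesis
      unfolding f_def by (rule order_trans) simp
  qed
  have meas: "?E i \<in> sets \<mu>" for i
    by simp
  have "(\<integral>\<^sup>+ x. ennreal (exp (\<theta> * \<bar>x\<bar> powr \<alpha>)) \<partial>\<mu>)
      \<le> (\<integral>\<^sup>+ x. ennreal (?w 0) + (\<Sum>i. ennreal (?w i) * indicator (?E i) x) \<partial>\<mu>)"
    by (intro nn_integral_mono pw)
  also have "\<dots> = ennreal (?w 0) + (\<Sum>i. ennreal (?w i) * emeasure \<mu> (?E i))"
    using meas emeasure_space_1
    by (simp add: nn_integral_add nn_integral_suminf nn_integral_cmult)
  also have "(\<Sum>i. ennreal (?w i) * emeasure \<mu> (?E i))
      \<le> (\<Sum>i. ennreal (2 * exp (\<theta> + (\<theta> - \<theta>') * real J) * exp (\<theta> - \<theta>') ^ i))"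
  proof (intro suminf_le summableI)
    fix i
    have "ennreal (?w i) * emeasure \<mu> (?E i) = ennreal (?w i * measure \<mu> (?E i))"
      by (simp add: emeasure_eq_measure ennreal_mult)
    also have "?w i * measure \<mu> (?E i) \<le> ?w i * (2 * exp (- \<theta>' * real (i + J)))"
      by (intro mult_left_mono tail_J) auto
    also have "\<dots> = 2 * exp (\<theta> + (\<theta> - \<theta>') * real J) * exp (\<theta> - \<theta>') ^ i"
      by (simp add: exp_of_nat_mult[symmetric] exp_add[symmetric] algebra_simps)
    finally show "ennreal (?w i) * emeasure \<mu> (?E i)
        \<le> ennreal (2 * exp (\<theta> + (\<theta> - \<theta>') * real J) * exp (\<theta> - \<theta>') ^ i)"
      by (simp add: ennreal_leI)
  qed
  also have "\<dots> = ennreal (\<Sum>i. 2 * exp (\<theta> + (\<theta> - \<theta>') * real J) * exp (\<theta> - \<theta>') ^ i)"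
    using \<theta>' by (intro suminf_ennreal2 summable_mult summable_geometric) auto
  also have "ennreal (?w 0) + \<dots> < \<infinity>"
    by simp
  finally show ?thesis
    by (simp add: add_left_mono)
qed

text \<open>On \<open>A < \<bar>x\<bar>\<close> part of the exponential moment is traded for decay
  in \<open>A\<close>: the surplus \<open>\<delta> = \<theta>' - \<theta>\<close> is evaluated at
  \<open>A\<close>, the rest is integrated. The constants do not depend on \<open>A\<close>, so a
  threshold growing with \<open>n\<close> may be inserted. The moment bound serves the upper
  estimate, the tail bound the lower one.\<close>

lemma truncated_exp_moment:
  assumes \<theta>: "0 \<le> \<theta>" "\<theta> < lam"
  shows "\<exists>C \<delta>. 0 \<le> C \<and> 0 < \<delta> \<and> (\<forall>A\<ge>0.
    (\<integral>\<^sup>+ x. ennreal (exp (\<theta> * (if A < \<bar>x\<bar> then \<bar>x\<bar> powr \<alpha> else 0))) \<partial>\<mu>)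
      \<le> ennreal (1 + C * exp (- \<delta> * A powr \<alpha>)) \<and>
    measure \<mu> {x. A < \<bar>x\<bar>} \<le> C * exp (- \<delta> * A powr \<alpha>))"
proof -
  define \<theta>' where "\<theta>' = (\<theta> + lam) / 2"
  define \<delta> where "\<delta> = \<theta>' - \<theta>"
  have \<theta>': "0 \<le> \<theta>'" "\<theta>' < lam" and \<delta>: "0 < \<delta>"
    using \<theta> by (auto simp: \<theta>'_def \<delta>_def field_simps)
  define C where "C = enn2real (\<integral>\<^sup>+ x. ennreal (exp (\<theta>' * \<bar>x\<bar> powr \<alpha>)) \<partial>\<mu>)"
  have C: "(\<integral>\<^sup>+ x. ennreal (exp (\<theta>' * \<bar>x\<bar> powr \<alpha>)) \<partial>\<mu>) = ennreal C"
    using exp_moment_finite[OF \<theta>'] by (simp add: C_def)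
  have C0: "0 \<le> C"
    by (simp add: C_def)
  have int: "(\<integral>\<^sup>+ x. ennreal (exp (- \<delta> * a)) * ennreal (exp (\<theta>' * \<bar>x\<bar> powr \<alpha>)) \<partial>\<mu>)
      = ennreal (C * exp (- \<delta> * a))" for a
    using C0 by (subst nn_integral_cmult) (auto simp: C ennreal_mult mult.commute)
  have big: "A powr \<alpha> \<le> \<bar>x\<bar> powr \<alpha>" if "0 \<le> A" "A < \<bar>x\<bar>" for A x :: real
    using that alpha_pos by (intro powr_mono2) auto
  have "(\<integral>\<^sup>+ x. ennreal (exp (\<theta> * (if A < \<bar>x\<bar> then \<bar>x\<bar> powr \<alpha> else 0))) \<partial>\<mu>)
       \<le> ennreal (1 + C * exp (- \<delta> * A powr \<alpha>))" if A: "0 \<le> A" for A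
  proof -
    have "exp (\<theta> * (if A < \<bar>x\<bar> then \<bar>x\<bar> powr \<alpha> else 0))
        \<le> 1 + exp (- \<delta> * A powr \<alpha>) * exp (\<theta>' * \<bar>x\<bar> powr \<alpha>)" for x
    proof (cases "A < \<bar>x\<bar>")
      case True
      have "\<delta> * A powr \<alpha> \<le> \<delta> * \<bar>x\<bar> powr \<alpha>"
        using big[OF A True] \<delta> by simp
      then have "exp (\<theta> * \<bar>x\<bar> powr \<alpha>) \<le> exp (- \<delta> * A powr \<alpha> + \<theta>' * \<bar>x\<bar> powr \<alpha>)"
        by (simp add: \<delta>_def algebra_simps)
      also have "\<dots> \<le> 1 + exp (- \<delta> * A powr \<alpha>) * exp (\<theta>' * \<bar>x\<bar> powr \<alpha>)"
        by (simp only: exp_add)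
      finally show ?thesis
        using True by simp
    qed simp
    then have "(\<integral>\<^sup>+ x. ennreal (exp (\<theta> * (if A < \<bar>x\<bar> then \<bar>x\<bar> powr \<alpha> else 0))) \<partial>\<mu>)
        \<le> (\<integral>\<^sup>+ x. 1 + ennreal (exp (- \<delta> * A powr \<alpha>)) * ennreal (exp (\<theta>' * \<bar>x\<bar> powr \<alpha>)) \<partial>\<mu>)"
      by (intro nn_integral_mono)
        (simp add: ennreal_mult[symmetric] ennreal_plus[symmetric] ennreal_leI flip: ennreal_1 del: ennreal_plus)
    also have "\<dots> = 1 + ennreal (C * exp (- \<delta> * A powr \<alpha>))"
      using emeasure_space_1 by (subst nn_integral_add) (simp_all only: int, simp_all)
    also have "\<dots> = ennreal (1 + C * exp (- \<delta> * A powr \<alpha>))"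
      using C0 by (simp flip: ennreal_1)
    finally show ?thesis .
  qed
  moreover have "measure \<mu> {x. A < \<bar>x\<bar>} \<le> C * exp (- \<delta> * A powr \<alpha>)" if A: "0 \<le> A" for A
  proof -
    have "1 \<le> exp (- \<delta> * A powr \<alpha>) * exp (\<theta>' * \<bar>x\<bar> powr \<alpha>)" if "A < \<bar>x\<bar>" for x
    proof -
      have "\<delta> * A powr \<alpha> \<le> \<theta>' * \<bar>x\<bar> powr \<alpha>"
        using big[OF A that] \<delta> \<theta> by (intro mult_mono) (auto simp: \<delta>_def)
      then show ?thesis
        by (simp flip: exp_add)
    qed
    then have "indicator {x. A < \<bar>x\<bar>} x
        \<le> ennreal (exp (- \<delta> * A powr \<alpha>)) * ennreal (exp (\<theta>' * \<bar>x\<bar> powr \<alpha>))" for x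
      by (auto simp: indicator_def simp flip: ennreal_mult)
    then have "(\<integral>\<^sup>+ x. indicator {x. A < \<bar>x\<bar>} x \<partial>\<mu>)
        \<le> (\<integral>\<^sup>+ x. ennreal (exp (- \<delta> * A powr \<alpha>)) * ennreal (exp (\<theta>' * \<bar>x\<bar> powr \<alpha>)) \<partial>\<mu>)"
      by (intro nn_integral_mono)
    then have "emeasure \<mu> {x. A < \<bar>x\<bar>} \<le> ennreal (C * exp (- \<delta> * A powr \<alpha>))"
      unfolding int by simp
    then show ?thesis
      using C0 by (simp add: emeasure_eq_measure)
  qed
  ultimately show ?thesis
    using C0 \<delta> by blast
qed

end

section \<open>Fields supported on finitely many levels\<close>

definition tree_upto :: "nat \<Rightarrow> nat \<Rightarrow> nat list set" where
  "tree_upto b k = {v \<in> tree b - {[]}. length v \<le> k}"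

lemma tree_upto_subset: "tree_upto b k \<subseteq> tree b - {[]}"
  by (auto simp: tree_upto_def)

lemma finite_tree_upto: "finite (tree_upto b k)"
  by (rule finite_subset[OF _ finite_lists_length_le[of "{1..b}" k]])
    (auto simp: tree_upto_def mem_tree_iff)

lemma card_tree_upto_le:
  assumes "2 \<le> b"
  shows "card (tree_upto b k) \<le> b ^ Suc k"
proof -
  have "card (tree_upto b k) \<le> card {v. set v \<subseteq> {1..b} \<and> length v \<le> k}"
    by (intro card_mono finite_lists_length_le) (auto simp: tree_upto_def mem_tree_iff)
  also have "\<dots> = (\<Sum>i\<le>k. b ^ i)"
    by (simp add: card_lists_length_le)
  also have "\<dots> \<le> b ^ Suc k"
  proof (induction k)
    case (Suc k)
    have "(\<Sum>i\<le>Suc k. b ^ i) \<le> b ^ Suc k + b ^ Suc k"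
      using Suc by simp
    also have "\<dots> = 2 * b ^ Suc k"
      by simp
    also have "\<dots> \<le> b * b ^ Suc k"
      using assms by (rule mult_right_mono) simp
    finally show ?case
      by simp
  qed (use assms in simp)
  finally show ?thesis .
qed

lemma tree_upto_nonempty:
  assumes "0 < b" "0 < k"
  shows "tree_upto b k \<noteq> {}"
proof -
  have "[1] \<in> tree_upto b k"
    using assms by (auto simp: tree_upto_def mem_tree_iff)
  then show ?thesis
    by blast
qed

lemma tree_level_subset_upto: "k < K \<Longrightarrow> tree_level b (Suc k) \<subseteq> tree_upto b K"
  by (auto simp: tree_upto_def tree_def tree_level_def)

lemma field_supported_on_tree_upto:
  assumes "\<And>v. v \<notin> tree_upto b K \<Longrightarrow> h v = 0"
  shows "h \<in> field_space b"
    and "field_norm b h = (\<Sum>k<K. level_mean b h (Suc k))"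
  using field_space_finite_levels[of h b K] assms by (auto simp: tree_upto_def)

text \<open>The norm averages over each level, so an error bound depending only on the generation is
  paid once per generation and not once per site.\<close>

lemma field_norm_le_sum:
  assumes "0 < b" "\<And>v. v \<notin> tree_upto b K \<Longrightarrow> h v = 0"
    and "\<And>v. v \<in> tree_upto b K \<Longrightarrow> \<bar>h v\<bar> \<le> \<beta> (length v)"
  shows "field_norm b h \<le> (\<Sum>k<K. \<beta> (Suc k))"
proof -
  have "level_mean b h (Suc k) \<le> \<beta> (Suc k)" if "k < K" for k
  proof (rule level_mean_le[OF assms(1)])
    fix v assume v: "v \<in> tree_level b (Suc k)"
    then have "v \<in> tree_upto b K" "length v = Suc k"
      using tree_level_subset_upto[OF that] by (auto simp: tree_level_def)
    then show "\<bar>h v\<bar> \<le> \<beta> (Suc k)"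
      using assms(3)[of v] by simp
  qed
  then have "(\<Sum>k<K. level_mean b h (Suc k)) \<le> (\<Sum>k<K. \<beta> (Suc k))"
    by (intro sum_mono) auto
  moreover have "field_norm b h = (\<Sum>k<K. level_mean b h (Suc k))"
    using assms(2) by (rule field_supported_on_tree_upto)
  ultimately show ?thesis
    by simp
qed

text \<open>The values lie in a finite-dimensional subspace, where rational fields form a countable
  dense set. The preimage of an open set is then a countable union of preimages of balls, and
  distances to fixed fields are finite sums of measurable functions.\<close>

lemma measurable_tree_upto_field:
  assumes b: "0 < b"
    and meas: "\<And>v. v \<in> tree_upto b K \<Longrightarrow> (\<lambda>\<omega>. V \<omega> v) \<in> borel_measurable M"
    and V_zero: "\<And>\<omega> v. v \<notin> tree_upto b K \<Longrightarrow> V \<omega> v = 0"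
  shows "V \<in> measurable M (borel_of (field_topology b))"
proof -
  interpret Metric_space "field_space b" "field_dist b"
    using b by (rule Metric_space_field_space)
  let ?F = "tree_upto b K"
  \<comment> \<open>Functions in \<open>PiE\<close> are \<open>undefined\<close> outside
    \<open>?F\<close>; the case distinction replaces this by 0 to obtain fields.\<close>
  define D where "D = (\<lambda>g v. if v \<in> ?F then g v else 0) ` (PiE ?F (\<lambda>_. \<rat> :: real set))"
  have D_countable: "countable D"
    unfolding D_def by (intro countable_image countable_PiE finite_tree_upto countable_rat)
  have D_zero: "d v = 0" if "d \<in> D" "v \<notin> ?F" for d v
    using that by (auto simp: D_def)
  have V_space: "V \<omega> \<in> field_space b" for \<omega>
    using V_zero by (rule field_supported_on_tree_upto)
  have D_space: "d \<in> field_space b" if "d \<in> D" for d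
    using D_zero[OF that] by (rule field_supported_on_tree_upto)
  have dist_meas: "(\<lambda>\<omega>. field_dist b d (V \<omega>)) \<in> borel_measurable M" if d: "d \<in> D" for d
  proof -
    have "field_dist b d (V \<omega>) = (\<Sum>k<K. level_mean b (\<lambda>v. d v - V \<omega> v) (Suc k))" for \<omega>
      unfolding field_dist_def using D_zero[OF d] V_zero by (intro field_supported_on_tree_upto(2)) auto
    moreover have "(\<lambda>\<omega>. \<Sum>k<K. level_mean b (\<lambda>v. d v - V \<omega> v) (Suc k)) \<in> borel_measurable M"
      unfolding level_mean_def using tree_level_subset_upto[of _ K b]
      by (intro borel_measurable_sum borel_measurable_divide borel_measurable_abs
          borel_measurable_diff borel_measurable_const meas) auto
    ultimately show ?thesis
      by simp
  qed
  have dense: "\<exists>d\<in>D. field_dist b d (V \<omega>) < q" if q: "0 < q" for \<omega> q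
  proof -
    let ?\<epsilon> = "q / (real K + 1)"
    have \<epsilon>: "0 < ?\<epsilon>"
      using q by simp
    have "\<forall>v. \<exists>y\<in>\<rat>. \<bar>y - V \<omega> v\<bar> < ?\<epsilon>"
    proof
      fix v
      obtain y where "y \<in> \<rat>" "V \<omega> v < y" "y < V \<omega> v + ?\<epsilon>"
        using Rats_dense_in_real[of "V \<omega> v" "V \<omega> v + ?\<epsilon>"] \<epsilon> by auto
      then show "\<exists>y\<in>\<rat>. \<bar>y - V \<omega> v\<bar> < ?\<epsilon>"
        by (intro bexI[of _ y]) auto
    qed
    then obtain g where g: "\<And>v. g v \<in> \<rat>" "\<And>v. \<bar>g v - V \<omega> v\<bar> < ?\<epsilon>"
      by metis
    let ?d = "\<lambda>v. if v \<in> ?F then restrict g ?F v else 0"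
    have "?d \<in> D"
      unfolding D_def using g(1) by (intro imageI) auto
    moreover have "field_dist b ?d (V \<omega>) \<le> (\<Sum>k<K. ?\<epsilon>)"
      unfolding field_dist_def using V_zero g(2) b
      by (intro field_norm_le_sum) (auto simp: less_imp_le)
    moreover have "(\<Sum>k<K. ?\<epsilon>) < q"
      using q by (simp add: field_simps)
    ultimately show ?thesis
      by force
  qed
  show ?thesis
    unfolding borel_of_def
  proof (rule measurable_measure_of)
    show "{U. openin (field_topology b) U} \<subseteq> Pow (topspace (field_topology b))"
      by (auto dest: openin_subset)
    show "V \<in> space M \<rightarrow> topspace (field_topology b)"
      using V_space b by (simp add: topspace_field_topology)
    fix U assume "U \<in> {U. openin (field_topology b) U}"
    then have U: "openin mtopology U"
      by (simp add: field_topology_def)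
    define P where "P = {(d, q). d \<in> D \<and> q \<in> \<rat> \<and> mball d q \<subseteq> U}"
    have "countable P"
      by (rule countable_subset[OF _ countable_SIGMA[OF D_countable countable_rat]])
        (auto simp: P_def)
    have "V -` U \<inter> space M = (\<Union>(d, q)\<in>P. {\<omega> \<in> space M. field_dist b d (V \<omega>) < q})"
    proof (intro equalityI subsetI)
      fix \<omega> assume \<omega>: "\<omega> \<in> V -` U \<inter> space M"
      then obtain r where r: "0 < r" "mball (V \<omega>) r \<subseteq> U"
        using U by (auto simp: openin_mtopology)
      \<comment> \<open>With radius below \<open>r / 2\<close> and a centre closer than
        \<open>q\<close> to \<open>V \<omega>\<close>, the rational ball stays inside the ball of
        radius \<open>r\<close> by the triangle inequality.\<close>
      obtain q where q: "q \<in> \<rat>" "0 < q" "q < r / 2"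
        using Rats_dense_in_real[of 0 "r / 2"] r(1) by auto
      obtain d where d: "d \<in> D" "field_dist b d (V \<omega>) < q"
        using dense[OF q(2)] by blast
      have "mball d q \<subseteq> mball (V \<omega>) r"
      proof
        fix x assume x: "x \<in> mball d q"
        then have "field_dist b (V \<omega>) x \<le> field_dist b (V \<omega>) d + field_dist b d x"
          using V_space D_space[OF d(1)] by (intro triangle) auto
        also have "\<dots> < r"
          using x d(2) q(3) by (auto simp: commute)
        finally show "x \<in> mball (V \<omega>) r"
          using x V_space by auto
      qed
      with r(2) d q(1) \<omega> show "\<omega> \<in> (\<Union>(d, q)\<in>P. {\<omega> \<in> space M. field_dist b d (V \<omega>) < q})"
        by (auto simp: P_def intro!: bexI[of _ "(d, q)"])
    next
      fix \<omega> assume "\<omega> \<in> (\<Union>(d, q)\<in>P. {\<omega> \<in> space M. field_dist b d (V \<omega>) < q})"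
      then obtain d q where "d \<in> D" "mball d q \<subseteq> U" "\<omega> \<in> space M" "field_dist b d (V \<omega>) < q"
        by (auto simp: P_def)
      moreover have "V \<omega> \<in> mball d q"
        using calculation V_space D_space by auto
      ultimately show "\<omega> \<in> V -` U \<inter> space M"
        by auto
    qed
    also have "\<dots> \<in> sets M"
      using \<open>countable P\<close> dist_meas
      by (intro sets.countable_UN'') (auto simp: P_def)
    finally show "V -` U \<inter> space M \<in> sets M" .
  qed
qed

section \<open>Asymptotics of the cutoff\<close>

lemma cutoff_le_ln:
  assumes "0 \<le> c" "1 \<le> n"
  shows "real (cutoff c n) \<le> c * ln (real n)"
proof -
  have "0 \<le> c * ln (real n)"
    using assms by simp
  then show ?thesis
    unfolding cutoff_def by linarith
qed

lemma cutoff_less: "1 \<le> n \<Longrightarrow> cutoff c n < n"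
  unfolding cutoff_def by linarith

lemma eventually_le_cutoff:
  assumes "0 < c"
  shows "\<forall>\<^sub>F n in sequentially. K \<le> cutoff c n"
proof -
  have "filterlim (\<lambda>n. c * ln (real n)) at_top sequentially"
    using assms by real_asymp
  then have "\<forall>\<^sub>F n in sequentially. real K \<le> c * ln (real n)"
    by (simp add: filterlim_at_top)
  with eventually_ge_at_top[of "Suc K"] show ?thesis
    by eventually_elim (auto simp: cutoff_def le_nat_iff le_floor_iff)
qed

text \<open>The quantity \<open>m_n\<close> of the model as a real number; for
  \<open>1 \<le> n\<close> the natural subtraction is exact by \<open>cutoff_less\<close>.\<close>

definition depth :: "real \<Rightarrow> nat \<Rightarrow> real" where
  "depth c n = real (n - cutoff c n)"

lemma depth_le: "depth c n \<le> real n"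
  by (simp add: depth_def)

lemma depth_pos: "1 \<le> n \<Longrightarrow> 0 < depth c n"
  using cutoff_less[of n c] by (simp add: depth_def)

lemma depth_ge:
  assumes "0 \<le> c" "1 \<le> n"
  shows "real n - c * ln (real n) \<le> depth c n"
  using cutoff_le_ln[OF assms] cutoff_less[OF assms(2), of c] by (simp add: depth_def of_nat_diff)

text \<open>The cutoff is logarithmic, so the natural speed in terms of \<open>depth c n\<close> may
  be exchanged for the speed in terms of \<open>n\<close>.\<close>

lemma depth_ratio_tendsto:
  assumes "0 \<le> c"
  shows "(\<lambda>n. depth c n / real n) \<longlonglongrightarrow> 1"
proof (rule tendsto_sandwich)
  show "(\<lambda>n. 1 - c * ln (real n) / real n) \<longlonglongrightarrow> 1"
    by real_asymp
  show "\<forall>\<^sub>F n in sequentially. 1 - c * ln (real n) / real n \<le> depth c n / real n"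
    using eventually_ge_at_top[of 1]
  proof eventually_elim
    case (elim n)
    then have "1 - c * ln (real n) / real n = (real n - c * ln (real n)) / real n"
      by (simp add: field_simps)
    also have "\<dots> \<le> depth c n / real n"
      using depth_ge[OF assms elim] by (rule divide_right_mono) simp
    finally show ?case .
  qed
  show "\<forall>\<^sub>F n in sequentially. depth c n / real n \<le> 1"
    using eventually_ge_at_top[of 1]
    by eventually_elim (use depth_le in \<open>auto simp: field_simps\<close>)
qed simp

lemma eventually_half_le_depth:
  assumes "0 \<le> c"
  shows "\<forall>\<^sub>F n in sequentially. real n / 2 \<le> depth c n"
proof -
  have "\<forall>\<^sub>F n in sequentially. 1 / 2 < depth c n / real n"
    by (rule order_tendstoD(1)[OF depth_ratio_tendsto[OF assms]]) simp
  with eventually_ge_at_top[of 1] show ?thesis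
    by eventually_elim (simp add: field_simps)
qed

lemma sqrt_depth_at_top:
  assumes "0 \<le> c"
  shows "filterlim (\<lambda>n. sqrt (depth c n)) at_top sequentially"
proof (rule filterlim_at_top_mono)
  show "filterlim (\<lambda>n. sqrt (real n / 2)) at_top sequentially"
    by real_asymp
  show "\<forall>\<^sub>F n in sequentially. sqrt (real n / 2) \<le> sqrt (depth c n)"
    using eventually_half_le_depth[OF assms] by eventually_elim simp
qed

text \<open>The exponent is chosen so that \<open>threshold \<alpha> n powr \<alpha> = (ln n)\<^sup>2\<close>: the tail probability at the
  threshold then beats the polynomially many sites, while the threshold itself stays far below
  \<open>sqrt n\<close>.\<close>

definition threshold :: "real \<Rightarrow> nat \<Rightarrow> real" where
  "threshold \<alpha> n = ln (real n) powr (2 / \<alpha>)"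

lemma threshold_nonneg: "0 \<le> threshold \<alpha> n"
  by (simp add: threshold_def)

text \<open>The expression bounds the norm of the discarded part, one term per generation: a power
  of \<open>ln n\<close> divided by something of order \<open>sqrt n\<close>.\<close>

lemma threshold_noise_tendsto:
  assumes "0 \<le> c" "0 < \<alpha>"
  shows "(\<lambda>n. real (cutoff c n) * (threshold \<alpha> n / sqrt (depth c n))) \<longlonglongrightarrow> 0"
proof (rule tendsto_sandwich[OF _ _ tendsto_const])
  show "(\<lambda>n. c * ln (real n) * (ln (real n) powr (2 / \<alpha>) / sqrt (real n / 2))) \<longlonglongrightarrow> 0"
    using assms(2) by real_asymp
  show "\<forall>\<^sub>F n in sequentially. real (cutoff c n) * (threshold \<alpha> n / sqrt (depth c n))
      \<le> c * ln (real n) * (ln (real n) powr (2 / \<alpha>) / sqrt (real n / 2))"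
    using eventually_half_le_depth[OF assms(1)] eventually_ge_at_top[of 1]
  proof eventually_elim
    case (elim n)
    then show ?case
      unfolding threshold_def using assms(1)
      by (intro mult_mono cutoff_le_ln divide_left_mono) auto
  qed
qed (auto simp: threshold_nonneg depth_def)

text \<open>The number of sites grows at most like a power of \<open>n\<close>, with exponent
  \<open>c * ln b\<close>, while the exponential factor is
  \<open>exp (- \<delta> * (ln n)^2)\<close> and beats every power.\<close>

lemma card_threshold_tendsto:
  assumes b: "2 \<le> b" and c: "0 < c" and \<alpha>: "0 < \<alpha>" and \<delta>: "0 < \<delta>"
  shows "(\<lambda>n. real (card (tree_upto b (cutoff c n))) * exp (- \<delta> * threshold \<alpha> n powr \<alpha>)) \<longlonglongrightarrow> 0"
proof (rule tendsto_sandwich[OF _ _ tendsto_const])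
  define d where "d = c * ln (real b)"
  have d: "0 < d"
    using b c by (simp add: d_def)
  show "(\<lambda>n. real b * exp (d * ln (real n) - \<delta> * ln (real n) ^ 2)) \<longlonglongrightarrow> 0"
    using d \<delta> b by real_asymp
  show "\<forall>\<^sub>F n in sequentially. real (card (tree_upto b (cutoff c n))) * exp (- \<delta> * threshold \<alpha> n powr \<alpha>)
      \<le> real b * exp (d * ln (real n) - \<delta> * ln (real n) ^ 2)"
    using eventually_gt_at_top[of 1]
  proof eventually_elim
    case (elim n)
    have "real (card (tree_upto b (cutoff c n))) \<le> real (b ^ Suc (cutoff c n))"
      using card_tree_upto_le[OF b] of_nat_le_iff by blast
    also have "\<dots> = real b * exp (real (cutoff c n) * ln (real b))"
      using b by (simp add: exp_of_nat_mult)
    also have "\<dots> \<le> real b * exp (d * ln (real n))"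
      using cutoff_le_ln[of c n] c b elim by (simp add: d_def mult_right_mono mult.assoc[symmetric] mult.commute[of c] )
    finally have "real (card (tree_upto b (cutoff c n))) * exp (- \<delta> * threshold \<alpha> n powr \<alpha>)
        \<le> real b * exp (d * ln (real n)) * exp (- \<delta> * threshold \<alpha> n powr \<alpha>)"
      by (rule mult_right_mono) simp
    moreover have "threshold \<alpha> n powr \<alpha> = ln (real n) ^ 2"
      using \<alpha> elim by (simp add: threshold_def powr_powr)
    ultimately show ?case
      by (simp add: exp_diff exp_minus field_simps)
  qed
qed auto

section \<open>The large deviation bounds\<close>

lemma openin_borel_of: "openin T U \<Longrightarrow> U \<in> sets (borel_of T)"
  by (auto simp: borel_of_def sets_measure_of_conv dest: openin_subset)

lemma closedin_borel_of:
  assumes "closedin T C"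
  shows "C \<in> sets (borel_of T)"
proof -
  have "topspace T - (topspace T - C) \<in> sets (borel_of T)"
    using assms by (intro sets.Diff openin_borel_of) (auto simp: closedin_def)
  then show ?thesis
    using closedin_subset[OF assms] by (simp add: double_diff)
qed

locale iid_displacements = prob_space M + law: weibull_law \<mu> \<alpha> lam
  for M :: "'a measure" and \<mu> \<alpha> lam +
  fixes b :: nat and c :: real and Xs :: "nat list \<Rightarrow> 'a \<Rightarrow> real"
  assumes b_ge_2: "2 \<le> b" and c_pos: "0 < c"
    and indep: "indep_vars (\<lambda>_. borel) Xs (tree b - {[]})"
    and distr_Xs: "\<And>v. v \<in> tree b - {[]} \<Longrightarrow> distr M borel (Xs v) = \<mu>"
begin

section \<open>The displacement field on its finite set of sites\<close>

abbreviation Y :: "nat \<Rightarrow> 'a \<Rightarrow> nat list \<Rightarrow> real" where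
  "Y \<equiv> displacement b c Xs"

abbreviation sites :: "nat \<Rightarrow> nat list set" where
  "sites n \<equiv> tree_upto b (cutoff c n)"

lemma measurable_Xs: "v \<in> tree b - {[]} \<Longrightarrow> Xs v \<in> borel_measurable M"
  using indep by (auto simp: indep_vars_def)

lemma measurable_Xs_site: "v \<in> sites n \<Longrightarrow> Xs v \<in> borel_measurable M"
  using tree_upto_subset by (blast intro: measurable_Xs)

lemma prob_Xs:
  assumes "v \<in> tree b - {[]}" "B \<in> sets borel"
  shows "prob (Xs v -` B \<inter> space M) = measure \<mu> B"
  using measure_distr[OF measurable_Xs[OF assms(1)] assms(2)] distr_Xs[OF assms(1)] by simp

lemma Y_site: "v \<in> sites n \<Longrightarrow> Y n \<omega> v = Xs v \<omega> / sqrt (depth c n)"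
  by (auto simp: displacement_def tree_upto_def depth_def)

lemma Y_off_sites: "v \<notin> sites n \<Longrightarrow> Y n \<omega> v = 0"
  by (auto simp: displacement_def tree_upto_def)

lemma Y_space: "Y n \<omega> \<in> field_space b"
  using Y_off_sites by (rule field_supported_on_tree_upto)

lemma measurable_Y: "Y n \<in> measurable M (borel_of (field_topology b))"
proof (rule measurable_tree_upto_field[where K = "cutoff c n"])
  show "(\<lambda>\<omega>. Y n \<omega> v) \<in> borel_measurable M" if "v \<in> sites n" for v
    using measurable_Xs_site[OF that] by (simp add: Y_site that)
qed (use b_ge_2 Y_off_sites in auto)

section \<open>Energy of the sites above the threshold\<close>

definition site_energy :: "nat \<Rightarrow> nat list \<Rightarrow> 'a \<Rightarrow> real" where
  "site_energy n v \<omega> = (if threshold \<alpha> n < \<bar>Xs v \<omega>\<bar> then \<bar>Xs v \<omega>\<bar> powr \<alpha> else 0)"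

lemma measurable_site_energy:
  assumes "v \<in> sites n"
  shows "site_energy n v \<in> borel_measurable M"
proof -
  note [measurable] = measurable_Xs_site[OF assms]
  show ?thesis
    unfolding site_energy_def by measurable
qed

text \<open>A Chernoff bound with parameter \<open>\<theta>\<close>: independence factorises the
  exponential moment, and \<open>1 + ?x \<le> exp ?x\<close> bounds the product by
  \<open>exp 1\<close> once the number of sites times \<open>?x\<close> is below 1. The level
  \<open>R\<close> enters only through Markov's inequality, so the estimate is uniform in
  \<open>R\<close>, which is later chosen to grow with \<open>n\<close>.\<close>

lemma eventually_energy_tail:
  assumes \<theta>: "0 \<le> \<theta>" "\<theta> < lam"
  shows "\<forall>\<^sub>F n in sequentially. \<forall>R.
    prob {\<omega> \<in> space M. R \<le> (\<Sum>v\<in>sites n. site_energy n v \<omega>)} \<le> exp (1 - \<theta> * R)"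
proof -
  obtain C \<delta> where C: "0 \<le> C" and \<delta>: "0 < \<delta>"
    and mom: "\<And>A. 0 \<le> A \<Longrightarrow> (\<integral>\<^sup>+ x. ennreal (exp (\<theta> * (if A < \<bar>x\<bar> then \<bar>x\<bar> powr \<alpha> else 0))) \<partial>\<mu>)
       \<le> ennreal (1 + C * exp (- \<delta> * A powr \<alpha>))"
    using law.truncated_exp_moment[OF \<theta>] by blast
  have "(\<lambda>n. C * (real (card (sites n)) * exp (- \<delta> * threshold \<alpha> n powr \<alpha>))) \<longlonglongrightarrow> C * 0"
    by (intro tendsto_mult_left card_threshold_tendsto b_ge_2 c_pos law.alpha_pos \<delta>)
  then have "\<forall>\<^sub>F n in sequentially. C * (real (card (sites n)) * exp (- \<delta> * threshold \<alpha> n powr \<alpha>)) < 1"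
    by (rule order_tendstoD) simp
  then show ?thesis
  proof eventually_elim
    case (elim n)
    let ?A = "threshold \<alpha> n" and ?u = "\<lambda>v \<omega>. exp (\<theta> * site_energy n v \<omega>)"
    let ?x = "C * exp (- \<delta> * threshold \<alpha> n powr \<alpha>)"
    have indep_u: "indep_vars (\<lambda>_. borel) (\<lambda>v \<omega>. ennreal (?u v \<omega>)) (sites n)"
      unfolding site_energy_def
      by (rule indep_vars_compose2[OF indep_vars_subset[OF indep tree_upto_subset]]) measurable
    have "(\<integral>\<^sup>+ \<omega>. ennreal (?u v \<omega>) \<partial>M) \<le> ennreal (1 + ?x)" if v: "v \<in> sites n" for v
    proof -
      have v': "v \<in> tree b - {[]}"
        using v tree_upto_subset by blast
      have "(\<integral>\<^sup>+ \<omega>. ennreal (?u v \<omega>) \<partial>M)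
          = (\<integral>\<^sup>+ x. ennreal (exp (\<theta> * (if ?A < \<bar>x\<bar> then \<bar>x\<bar> powr \<alpha> else 0))) \<partial>distr M borel (Xs v))"
        using measurable_Xs[OF v'] unfolding site_energy_def by (subst nn_integral_distr) auto
      also have "\<dots> \<le> ennreal (1 + ?x)"
        unfolding distr_Xs[OF v'] by (intro mom threshold_nonneg)
      finally show ?thesis .
    qed
    then have "(\<Prod>v\<in>sites n. \<integral>\<^sup>+ \<omega>. ennreal (?u v \<omega>) \<partial>M) \<le> (\<Prod>v\<in>sites n. ennreal (1 + ?x))"
      by (intro prod_mono_ennreal)
    also have "\<dots> = ennreal ((1 + ?x) ^ card (sites n))"
      using C by (subst ennreal_power[symmetric]) auto
    also have "\<dots> \<le> ennreal (exp 1)"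
    proof (rule ennreal_leI)
      have "(1 + ?x) ^ card (sites n) \<le> exp ?x ^ card (sites n)"
        using C by (intro power_mono exp_ge_add_one_self) auto
      also have "\<dots> = exp (real (card (sites n)) * ?x)"
        by (simp add: exp_of_nat_mult)
      also have "\<dots> \<le> exp 1"
        using elim by (simp add: mult_ac)
      finally show "(1 + ?x) ^ card (sites n) \<le> exp 1" .
    qed
    finally have prod: "(\<integral>\<^sup>+ \<omega>. (\<Prod>v\<in>sites n. ennreal (?u v \<omega>)) \<partial>M) \<le> ennreal (exp 1)"
      by (subst indep_vars_nn_integral[OF finite_tree_upto indep_u]) auto
    have [measurable]: "(\<lambda>\<omega>. \<Sum>v\<in>sites n. site_energy n v \<omega>) \<in> borel_measurable M"
      by (intro borel_measurable_sum measurable_site_energy)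
    have [measurable]: "(\<lambda>\<omega>. \<Prod>v\<in>sites n. ennreal (?u v \<omega>)) \<in> borel_measurable M"
      using measurable_site_energy by (intro borel_measurable_prod_ennreal) measurable
    show ?case
    proof
      fix R
      let ?E = "{\<omega> \<in> space M. R \<le> (\<Sum>v\<in>sites n. site_energy n v \<omega>)}"
      have "ennreal (exp (- \<theta> * R)) * (\<Prod>v\<in>sites n. ennreal (?u v \<omega>))
          = ennreal (exp (\<theta> * ((\<Sum>v\<in>sites n. site_energy n v \<omega>) - R)))" for \<omega>
        by (simp add: prod_ennreal ennreal_mult[symmetric] exp_sum[OF finite_tree_upto, symmetric]
            exp_add[symmetric] sum_distrib_left[symmetric] algebra_simps)
      then have "emeasure M ?E
          \<le> emeasure M {\<omega> \<in> space M. 1 \<le> ennreal (exp (- \<theta> * R)) * (\<Prod>v\<in>sites n. ennreal (?u v \<omega>))}"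
        using \<theta> by (intro emeasure_mono) auto
      also have "\<dots> \<le> ennreal (exp (- \<theta> * R)) *
          (\<integral>\<^sup>+ \<omega>. (\<Prod>v\<in>sites n. ennreal (?u v \<omega>)) * indicator (space M) \<omega> \<partial>M)"
        by (intro nn_integral_Markov_inequality) auto
      also have "(\<integral>\<^sup>+ \<omega>. (\<Prod>v\<in>sites n. ennreal (?u v \<omega>)) * indicator (space M) \<omega> \<partial>M)
          = (\<integral>\<^sup>+ \<omega>. (\<Prod>v\<in>sites n. ennreal (?u v \<omega>)) \<partial>M)"
        by (intro nn_integral_cong) auto
      also have "ennreal (exp (- \<theta> * R)) * \<dots> \<le> ennreal (exp (- \<theta> * R)) * ennreal (exp 1)"
        by (intro mult_left_mono prod) auto
      also have "\<dots> = ennreal (exp (1 - \<theta> * R))"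
        by (simp add: ennreal_mult[symmetric] exp_add[symmetric])
      finally show "prob ?E \<le> exp (1 - \<theta> * R)"
        by (simp add: emeasure_eq_measure)
    qed
  qed
qed


section \<open>Normalised logarithmic probabilities\<close>

definition log_prob :: "nat \<Rightarrow> (nat list \<Rightarrow> real) set \<Rightarrow> ereal" where
  "log_prob n \<Gamma> = ereal (1 / real n powr (\<alpha> / 2)) * ext_ln (prob {\<omega> \<in> space M. Y n \<omega> \<in> \<Gamma>})"

lemma log_prob_nonpos: "log_prob n \<Gamma> \<le> 0"
proof -
  have "ext_ln (prob {\<omega> \<in> space M. Y n \<omega> \<in> \<Gamma>}) \<le> 0"
    by (auto simp: ext_ln_def)
  then have "log_prob n \<Gamma> \<le> ereal (1 / real n powr (\<alpha> / 2)) * 0"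
    unfolding log_prob_def by (intro ereal_mult_left_mono) auto
  then show ?thesis
    by simp
qed

lemma log_prob_le:
  assumes "prob {\<omega> \<in> space M. Y n \<omega> \<in> \<Gamma>} \<le> exp r"
  shows "log_prob n \<Gamma> \<le> ereal (1 / real n powr (\<alpha> / 2) * r)"
proof -
  have "ext_ln (prob {\<omega> \<in> space M. Y n \<omega> \<in> \<Gamma>}) \<le> ereal r"
    using assms ln_mono[of "prob {\<omega> \<in> space M. Y n \<omega> \<in> \<Gamma>}" "exp r"] by (auto simp: ext_ln_def not_le)
  then have "log_prob n \<Gamma> \<le> ereal (1 / real n powr (\<alpha> / 2)) * ereal r"
    unfolding log_prob_def by (intro ereal_mult_left_mono) auto
  then show ?thesis
    by simp
qed

lemma le_log_prob:
  assumes "exp r \<le> prob {\<omega> \<in> space M. Y n \<omega> \<in> \<Gamma>}"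
  shows "ereal (1 / real n powr (\<alpha> / 2) * r) \<le> log_prob n \<Gamma>"
proof -
  have "0 < prob {\<omega> \<in> space M. Y n \<omega> \<in> \<Gamma>}"
    using assms exp_gt_zero by (rule order_less_le_trans[rotated])
  then have "ereal r \<le> ext_ln (prob {\<omega> \<in> space M. Y n \<omega> \<in> \<Gamma>})"
    using assms by (auto simp: ext_ln_def ln_ge_iff)
  then have "ereal (1 / real n powr (\<alpha> / 2)) * ereal r \<le> log_prob n \<Gamma>"
    unfolding log_prob_def by (intro ereal_mult_left_mono) auto
  then show ?thesis
    by simp
qed

lemma Y_event:
  assumes "\<Gamma> \<in> sets (borel_of (field_topology b))"
  shows "{\<omega> \<in> space M. Y n \<omega> \<in> \<Gamma>} \<in> events"
proof -
  have "{\<omega> \<in> space M. Y n \<omega> \<in> \<Gamma>} = Y n -` \<Gamma> \<inter> space M"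
    by auto
  then show ?thesis
    using measurable_sets[OF measurable_Y assms] by simp
qed

lemma near_event:
  assumes "h \<in> field_space b"
  shows "{\<omega> \<in> space M. field_dist b h (Y n \<omega>) < \<epsilon>} \<in> events"
proof -
  interpret Metric_space "field_space b" "field_dist b"
    using b_ge_2 by (intro Metric_space_field_space) simp
  have "{\<omega> \<in> space M. Y n \<omega> \<in> mball h \<epsilon>} \<in> events"
    by (intro Y_event openin_borel_of) (simp add: field_topology_def)
  then show ?thesis
    using assms Y_space by simp
qed

lemma log_prob_mono:
  assumes "\<Gamma> \<subseteq> \<Delta>" "\<Delta> \<in> sets (borel_of (field_topology b))"
  shows "log_prob n \<Gamma> \<le> log_prob n \<Delta>"
proof -
  have "prob {\<omega> \<in> space M. Y n \<omega> \<in> \<Gamma>} \<le> prob {\<omega> \<in> space M. Y n \<omega> \<in> \<Delta>}"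
    using assms by (intro finite_measure_mono Y_event) auto
  then have "ext_ln (prob {\<omega> \<in> space M. Y n \<omega> \<in> \<Gamma>}) \<le> ext_ln (prob {\<omega> \<in> space M. Y n \<omega> \<in> \<Delta>})"
    by (auto simp: ext_ln_def)
  then show ?thesis
    unfolding log_prob_def by (intro ereal_mult_left_mono) auto
qed

lemma sqrt_depth_powr: "sqrt (depth c n) powr \<alpha> = depth c n powr (\<alpha> / 2)"
proof -
  have "0 \<le> depth c n"
    by (simp add: depth_def)
  then show ?thesis
    by (simp add: powr_half_sqrt[symmetric] powr_powr)
qed

section \<open>Upper bound for closed sets\<close>

text \<open>Discarding the sites with \<open>\<bar>X\<^sub>v\<bar> \<le> threshold\<close> moves \<open>Y n \<omega>\<close> by less than \<open>\<delta>\<close>, so a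
  displacement field outside the \<open>\<delta>\<close>-neighbourhood of a sublevel set has large site energy.\<close>

lemma site_energy_ge:
  assumes n: "1 \<le> n" and L: "0 \<le> L"
    and noise: "real (cutoff c n) * (threshold \<alpha> n / sqrt (depth c n)) < \<delta>"
    and far: "\<And>g. g \<in> field_space b \<Longrightarrow> field_rate b \<alpha> lam g \<le> ennreal L \<Longrightarrow>
      \<delta> \<le> field_dist b g (Y n \<omega>)"
  shows "L / lam * depth c n powr (\<alpha> / 2) \<le> (\<Sum>v\<in>sites n. site_energy n v \<omega>)"
proof (rule ccontr)
  assume less: "\<not> ?thesis"
  let ?D = "depth c n powr (\<alpha> / 2)"
  have D: "0 < ?D"
    using depth_pos[OF n, of c] by simp
  \<comment> \<open>\<open>Z\<close> keeps the large displacements only. If their energy were too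
    small, \<open>Z\<close> would lie in the sublevel set, yet within distance less than
    \<open>\<delta>\<close> of \<open>Y n \<omega>\<close>, contradicting
    \<open>far\<close>.\<close>
  define Z where "Z = (\<lambda>v. if v \<in> sites n \<and> threshold \<alpha> n < \<bar>Xs v \<omega>\<bar> then Y n \<omega> v else 0)"
  have Z_off: "Z v = 0" if "v \<notin> sites n" for v
    using that by (simp add: Z_def)
  then have Z_space: "Z \<in> field_space b"
    by (rule field_supported_on_tree_upto)
  have Z_energy: "\<bar>Z v\<bar> powr \<alpha> = site_energy n v \<omega> / ?D" if "v \<in> sites n" for v
    using that depth_pos[OF n, of c] by (simp add: Z_def site_energy_def Y_site powr_divide sqrt_depth_powr)
  have "lam * (\<Sum>v\<in>F. \<bar>Z v\<bar> powr \<alpha>) \<le> L" if F: "finite F" for F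
  proof -
    have "(\<Sum>v\<in>F. \<bar>Z v\<bar> powr \<alpha>) = (\<Sum>v\<in>F \<inter> sites n. \<bar>Z v\<bar> powr \<alpha>)"
      using F Z_off by (intro sum.mono_neutral_right) auto
    also have "\<dots> \<le> (\<Sum>v\<in>sites n. \<bar>Z v\<bar> powr \<alpha>)"
      by (intro sum_mono2 finite_tree_upto) auto
    also have "\<dots> = (\<Sum>v\<in>sites n. site_energy n v \<omega>) / ?D"
      by (simp add: Z_energy sum_divide_distrib)
    also have "\<dots> \<le> L / lam"
      using less D by (simp add: field_simps)
    finally show ?thesis
      using law.lam_pos by (simp add: field_simps)
  qed
  then have "field_rate b \<alpha> lam Z \<le> ennreal L"
    using field_rate_le_iff[OF law.lam_pos L] by blast
  with Z_space have "\<delta> \<le> field_dist b Z (Y n \<omega>)"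
    by (rule far)
  also have "\<dots> \<le> (\<Sum>k<cutoff c n. threshold \<alpha> n / sqrt (depth c n))"
    unfolding field_dist_def
  proof (rule field_norm_le_sum)
    show "\<bar>Z v - Y n \<omega> v\<bar> \<le> threshold \<alpha> n / sqrt (depth c n)" if "v \<in> sites n" for v
      using that threshold_nonneg[of \<alpha> n]
      by (auto simp: Z_def Y_site depth_def intro!: divide_right_mono)
  qed (use b_ge_2 Z_off Y_off_sites in auto)
  also have "\<dots> < \<delta>"
    using noise by simp
  finally show False
    by simp
qed

text \<open>Working with real \<open>y\<close> below the infimum also covers an infinite infimum. An
  intermediate level \<open>L\<close> gives a compact sublevel set disjoint from \<open>C\<close>;
  the gap between them forces large site energy on the event, and the Chernoff bound
  finishes.\<close>

lemma limsup_log_prob_le: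
  assumes C: "closedin (field_topology b) C"
    and y: "0 < y" "ereal y < enn2ereal (INF h\<in>C. field_rate b \<alpha> lam h)"
  shows "limsup (\<lambda>n. log_prob n C) \<le> ereal (- y)"
proof -
  obtain L where L: "y < L" "ereal L < enn2ereal (INF h\<in>C. field_rate b \<alpha> lam h)"
    using ereal_dense2[OF y(2)] by auto
  then have L0: "0 < L"
    using y by simp
  have rate_gt: "ennreal L < field_rate b \<alpha> lam h" if "h \<in> C" for h
  proof -
    have "ennreal L < (INF h\<in>C. field_rate b \<alpha> lam h)"
      using L(2) L0 by (simp add: less_ennreal.rep_eq enn2ereal_ennreal)
    also have "\<dots> \<le> field_rate b \<alpha> lam h"
      using that by (rule INF_lower)
    finally show ?thesis .
  qed
  obtain \<delta> where \<delta>: "0 < \<delta>"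
    "\<And>g h. g \<in> {h \<in> field_space b. field_rate b \<alpha> lam h \<le> ennreal L} \<Longrightarrow> h \<in> C \<Longrightarrow> \<delta> \<le> field_dist b g h"
  proof (rule compactin_closedin_field_dist_gap)
    show "compactin (field_topology b) {h \<in> field_space b. field_rate b \<alpha> lam h \<le> ennreal L}"
      using b_ge_2 law.alpha_pos law.lam_pos L0 by (intro compactin_field_rate_sublevel) auto
    show "{h \<in> field_space b. field_rate b \<alpha> lam h \<le> ennreal L} \<inter> C = {}"
      using rate_gt by (auto simp: not_le[symmetric])
  qed (use b_ge_2 C in auto)
  \<comment> \<open>Since \<open>y < L\<close>, this is an admissible Chernoff parameter, and it is
    the one for which \<open>\<theta> * (L / lam) = y\<close>.\<close>
  define \<theta> where "\<theta> = lam * y / L"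
  have \<theta>: "0 \<le> \<theta>" "\<theta> < lam"
    using y L L0 law.lam_pos by (auto simp: \<theta>_def field_simps)
  let ?a = "\<lambda>n. real n powr (\<alpha> / 2)"
  have "\<forall>\<^sub>F n in sequentially. real (cutoff c n) * (threshold \<alpha> n / sqrt (depth c n)) < \<delta>"
    using threshold_noise_tendsto[of c \<alpha>] c_pos law.alpha_pos \<delta>(1) by (intro order_tendstoD) auto
  with eventually_energy_tail[OF \<theta>] eventually_ge_at_top[of 1]
  have "\<forall>\<^sub>F n in sequentially. log_prob n C \<le> ereal (1 / ?a n - y * (depth c n / real n) powr (\<alpha> / 2))"
  proof eventually_elim
    case (elim n)
    let ?D = "depth c n powr (\<alpha> / 2)" and ?R = "L / lam * depth c n powr (\<alpha> / 2)"
    have [measurable]: "(\<lambda>\<omega>. \<Sum>v\<in>sites n. site_energy n v \<omega>) \<in> borel_measurable M"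
      by (intro borel_measurable_sum measurable_site_energy)
    have "prob {\<omega> \<in> space M. Y n \<omega> \<in> C} \<le> prob {\<omega> \<in> space M. ?R \<le> (\<Sum>v\<in>sites n. site_energy n v \<omega>)}"
    proof (rule finite_measure_mono)
      have "?R \<le> (\<Sum>v\<in>sites n. site_energy n v \<omega>)" if "Y n \<omega> \<in> C" for \<omega>
        using that \<delta>(2) L0 elim(2,3) by (intro site_energy_ge[where \<delta> = \<delta>]) auto
      then show "{\<omega> \<in> space M. Y n \<omega> \<in> C} \<subseteq> {\<omega> \<in> space M. ?R \<le> (\<Sum>v\<in>sites n. site_energy n v \<omega>)}"
        by blast
    qed measurable
    also have "\<dots> \<le> exp (1 - \<theta> * ?R)"
      using elim(1) by blast
    finally have "log_prob n C \<le> ereal (1 / ?a n * (1 - \<theta> * ?R))"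
      by (rule log_prob_le)
    also have "\<theta> * ?R = y * ?D"
      using L0 law.lam_pos by (simp add: \<theta>_def)
    also have "1 / ?a n * (1 - y * ?D) = 1 / ?a n - y * (depth c n / real n) powr (\<alpha> / 2)"
      by (simp add: powr_divide depth_def algebra_simps diff_divide_distrib)
    finally show ?case .
  qed
  then have "limsup (\<lambda>n. log_prob n C)
      \<le> limsup (\<lambda>n. ereal (1 / ?a n - y * (depth c n / real n) powr (\<alpha> / 2)))"
    by (rule Limsup_mono)
  also have "\<dots> = ereal (- y)"
  proof (rule lim_imp_Limsup)
    have "(\<lambda>n. 1 / ?a n) \<longlonglongrightarrow> 0"
      using law.alpha_pos by real_asymp
    moreover have "(\<lambda>n. (depth c n / real n) powr (\<alpha> / 2)) \<longlonglongrightarrow> 1 powr (\<alpha> / 2)"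
      using c_pos by (intro tendsto_powr[OF depth_ratio_tendsto tendsto_const]) auto
    ultimately have "(\<lambda>n. 1 / ?a n - y * (depth c n / real n) powr (\<alpha> / 2)) \<longlonglongrightarrow> 0 - y * 1 powr (\<alpha> / 2)"
      by (intro tendsto_diff tendsto_mult_left)
    then show "(\<lambda>n. ereal (1 / ?a n - y * (depth c n / real n) powr (\<alpha> / 2))) \<longlonglongrightarrow> ereal (- y)"
      by simp
  qed simp
  finally show ?thesis .
qed


section \<open>Lower bound for open sets\<close>

text \<open>The event contains a product event: a window next to \<open>h v\<close>, on the side
  away from 0, at each site of the support, and a value below the threshold at every other site.
  Each window costs a factor 1/2 and all other sites together one more, which explains the
  denominator.\<close>

lemma prob_near_ge:
  assumes h_off: "\<And>v. v \<notin> tree_upto b K \<Longrightarrow> h v = 0" and \<epsilon>: "0 < \<epsilon>" and \<eta>: "0 < \<eta>"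
  defines "S \<equiv> {v \<in> tree_upto b K. h v \<noteq> 0}"
  shows "\<forall>\<^sub>F n in sequentially.
    exp (- (lam + \<eta>) * (\<Sum>v\<in>S. \<bar>h v\<bar> powr \<alpha>) * real n powr (\<alpha> / 2)) / 2 ^ Suc (card S)
      \<le> prob {\<omega> \<in> space M. field_dist b h (Y n \<omega>) < \<epsilon>}"
proof -
  \<comment> \<open>At most \<open>K\<close> levels carry a window error \<open>\<epsilon>'\<close>,
    in total less than \<open>\<epsilon> / 2\<close>; the other half is left for the noise of the
    remaining sites. The summand 1 covers \<open>K = 0\<close>.\<close>
  define \<epsilon>' where "\<epsilon>' = \<epsilon> / (2 * (real K + 1))"
  have \<epsilon>': "0 < \<epsilon>'"
    using \<epsilon> by (simp add: \<epsilon>'_def)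
  have K\<epsilon>': "real K * \<epsilon>' < \<epsilon> / 2"
    using \<epsilon> by (simp add: \<epsilon>'_def field_simps)
  let ?t = "\<lambda>n. sqrt (depth c n)" and ?A = "threshold \<alpha>"
  have S: "finite S" "S \<subseteq> tree_upto b K"
    using finite_tree_upto by (auto simp: S_def)
  obtain C \<delta> where C: "0 \<le> C" and \<delta>: "0 < \<delta>"
    and tail_le: "\<And>A. 0 \<le> A \<Longrightarrow> measure \<mu> {x. A < \<bar>x\<bar>} \<le> C * exp (- \<delta> * A powr \<alpha>)"
    using law.truncated_exp_moment[of 0] law.lam_pos by auto
  have "(\<lambda>n. C * (real (card (sites n)) * exp (- \<delta> * ?A n powr \<alpha>))) \<longlonglongrightarrow> C * 0"
    by (intro tendsto_mult_left card_threshold_tendsto b_ge_2 c_pos law.alpha_pos \<delta>)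
  then have ev_tail: "\<forall>\<^sub>F n in sequentially. C * (real (card (sites n)) * exp (- \<delta> * ?A n powr \<alpha>)) < 1 / 2"
    by (rule order_tendstoD) simp
  have ev_noise: "\<forall>\<^sub>F n in sequentially. real (cutoff c n) * (?A n / ?t n) < \<epsilon> / 2"
    using threshold_noise_tendsto[of c \<alpha>] c_pos law.alpha_pos \<epsilon> by (intro order_tendstoD) auto
  have ev_window: "\<forall>\<^sub>F n in sequentially. \<forall>v\<in>S. exp (- (lam + \<eta>) * (\<bar>h v\<bar> * ?t n) powr \<alpha>) / 2
      \<le> measure \<mu> {\<bar>h v\<bar> * ?t n<..(\<bar>h v\<bar> + \<epsilon>') * ?t n}"
  proof (intro eventually_ball_finite ballI S)
    fix v assume "v \<in> S"
    then have "0 < \<bar>h v\<bar>"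
      by (simp add: S_def)
    then show "\<forall>\<^sub>F n in sequentially. exp (- (lam + \<eta>) * (\<bar>h v\<bar> * ?t n) powr \<alpha>) / 2
      \<le> measure \<mu> {\<bar>h v\<bar> * ?t n<..(\<bar>h v\<bar> + \<epsilon>') * ?t n}"
      using c_pos by (intro eventually_compose_filterlim[OF law.eventually_window_ge[OF _ \<epsilon>' \<eta>]
          sqrt_depth_at_top]) auto
  qed
  \<comment> \<open>Asking for \<open>Suc K\<close> and not just \<open>K\<close> levels puts the
    support inside the sites and also makes the set of sites nonempty when
    \<open>K = 0\<close>.\<close>
  show ?thesis
    using ev_tail ev_noise ev_window eventually_le_cutoff[OF c_pos, of "Suc K"]
      eventually_ge_at_top[of 1]
  proof eventually_elim
    case (elim n)
    have t: "0 < ?t n"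
      using depth_pos[OF elim(5), of c] by simp
    define I where "I = (\<lambda>v. {\<bar>h v\<bar> * ?t n<..(\<bar>h v\<bar> + \<epsilon>') * ?t n})"
    \<comment> \<open>For negative \<open>h v\<close> the window is the mirror image of
      \<open>I v\<close>, with the open and closed ends exchanged, so that symmetry of the law gives
      it the same probability.\<close>
    define B where "B = (\<lambda>v. if v \<notin> S then {- ?A n..?A n} else if 0 < h v then I v
      else {- ((\<bar>h v\<bar> + \<epsilon>') * ?t n)..<- (\<bar>h v\<bar> * ?t n)})"
    have B_borel: "B v \<in> sets borel" for v
      by (simp add: B_def I_def)
    have S_sites: "S \<subseteq> sites n"
      using S(2) elim(4) by (auto simp: tree_upto_def)
    \<comment> \<open>A nonempty index set is required by \<open>indep_varsD\<close>, and it keeps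
      the intersection \<open>?E\<close> inside \<open>space M\<close>.\<close>
    have sites_ne: "sites n \<noteq> {}"
      using b_ge_2 elim(4) by (intro tree_upto_nonempty) auto
    let ?E = "\<Inter>v\<in>sites n. Xs v -` B v \<inter> space M"
    have near: "field_dist b h (Y n \<omega>) < \<epsilon>" if \<omega>: "\<omega> \<in> ?E" for \<omega>
    proof -
      define \<beta> where "\<beta> = (\<lambda>k. (if k \<le> K then \<epsilon>' else 0) + ?A n / ?t n)"
      have "\<bar>h v - Y n \<omega> v\<bar> \<le> \<beta> (length v)" if v: "v \<in> sites n" for v
      proof -
        have X: "Xs v \<omega> \<in> B v"
          using \<omega> v by blast
        show ?thesis
        proof (cases "v \<in> S")
          case True
          then have "length v \<le> K"
            using S(2) by (auto simp: tree_upto_def)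
          moreover have "\<bar>h v - Xs v \<omega> / ?t n\<bar> \<le> \<epsilon>'"
          proof (cases "0 < h v")
            case pos: True
            then have "h v * ?t n < Xs v \<omega>" "Xs v \<omega> \<le> (h v + \<epsilon>') * ?t n"
              using X True by (auto simp: B_def I_def)
            then have "h v < Xs v \<omega> / ?t n" "Xs v \<omega> / ?t n \<le> h v + \<epsilon>'"
              using t by (simp_all add: pos_less_divide_eq pos_divide_le_eq)
            then show ?thesis
              by linarith
          next
            case False
            then have "- ((- h v + \<epsilon>') * ?t n) \<le> Xs v \<omega>" "Xs v \<omega> < - (- h v * ?t n)"
              using X True by (auto simp: B_def)
            then have "(h v - \<epsilon>') * ?t n \<le> Xs v \<omega>" "Xs v \<omega> < h v * ?t n"
              by (simp_all add: algebra_simps)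
            then have "h v - \<epsilon>' \<le> Xs v \<omega> / ?t n" "Xs v \<omega> / ?t n < h v"
              using t by (simp_all only: pos_le_divide_eq pos_divide_less_eq)
            then show ?thesis
              by linarith
          qed
          moreover have "0 \<le> ?A n / ?t n"
            using t threshold_nonneg by (intro divide_nonneg_nonneg) auto
          ultimately show ?thesis
            unfolding \<beta>_def Y_site[OF v] by simp
        next
          case False
          then have "h v = 0"
            using h_off by (auto simp: S_def)
          moreover have "\<bar>Xs v \<omega>\<bar> \<le> ?A n"
            using X False by (auto simp: B_def)
          then have "\<bar>Xs v \<omega>\<bar> / ?t n \<le> ?A n / ?t n"
            using t by (intro divide_right_mono) auto
          ultimately show ?thesis
            using t \<epsilon>' by (simp add: \<beta>_def Y_site[OF v])
        qed
      qed
      moreover have "h v - Y n \<omega> v = 0" if "v \<notin> sites n" for v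
        using that h_off[of v] elim(4) Y_off_sites[OF that, of \<omega>] by (auto simp: tree_upto_def)
      ultimately have "field_dist b h (Y n \<omega>) \<le> (\<Sum>k<cutoff c n. \<beta> (Suc k))"
        unfolding field_dist_def using b_ge_2 by (intro field_norm_le_sum) auto
      also have "\<dots> = (\<Sum>k<cutoff c n. if Suc k \<le> K then \<epsilon>' else 0) + real (cutoff c n) * (?A n / ?t n)"
        by (simp add: \<beta>_def sum.distrib)
      also have "(\<Sum>k<cutoff c n. if Suc k \<le> K then \<epsilon>' else 0) = (\<Sum>k<K. \<epsilon>')"
        using elim(4) by (intro sum.mono_neutral_cong_right) auto
      also have "\<dots> < \<epsilon> / 2"
        using K\<epsilon>' by simp
      finally show ?thesis
        using elim(2) by linarith
    qed
    have window: "exp (- (lam + \<eta>) * \<bar>h v\<bar> powr \<alpha> * real n powr (\<alpha> / 2)) / 2 \<le> measure \<mu> (B v)"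
      if v: "v \<in> S" for v
    proof -
      \<comment> \<open>Passing from \<open>depth c n\<close> to the larger \<open>n\<close> only
        lowers the bound, as the coefficient is nonpositive.\<close>
      have "depth c n powr (\<alpha> / 2) \<le> real n powr (\<alpha> / 2)"
        using depth_le[of c n] law.alpha_pos by (intro powr_mono2) (auto simp: depth_def)
      then have "- (lam + \<eta>) * \<bar>h v\<bar> powr \<alpha> * real n powr (\<alpha> / 2)
          \<le> - (lam + \<eta>) * \<bar>h v\<bar> powr \<alpha> * depth c n powr (\<alpha> / 2)"
        using law.lam_pos \<eta> by (intro mult_left_mono_neg mult_nonpos_nonneg) auto
      then have "exp (- (lam + \<eta>) * \<bar>h v\<bar> powr \<alpha> * real n powr (\<alpha> / 2)) / 2
          \<le> exp (- (lam + \<eta>) * (\<bar>h v\<bar> * ?t n) powr \<alpha>) / 2"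
        using t by (simp add: powr_mult sqrt_depth_powr mult.assoc)
      also have "\<dots> \<le> measure \<mu> (I v)"
        using elim(3) v by (simp add: I_def)
      also have "\<dots> = measure \<mu> (B v)"
      proof (cases "0 < h v")
        case False
        have "uminus -` I v = {- ((\<bar>h v\<bar> + \<epsilon>') * ?t n)..<- (\<bar>h v\<bar> * ?t n)}"
          by (auto simp: I_def)
        then show ?thesis
          using v False law.measure_uminus_vimage[of "I v"] by (simp add: B_def I_def)
      qed (use v in \<open>simp add: B_def\<close>)
      finally show ?thesis .
    qed
    let ?p = "measure \<mu> {x. ?A n < \<bar>x\<bar>}" and ?R = "sites n - S"
    have p: "?p \<le> C * exp (- \<delta> * ?A n powr \<alpha>)"
      by (intro tail_le threshold_nonneg)
    \<comment> \<open>Bernoulli's inequality acts as a union bound for the sites off the support;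
      their expected number of exceedances is below 1/2.\<close>
    have others: "1 / 2 \<le> (\<Prod>v\<in>?R. measure \<mu> (B v))"
    proof -
      have "{- ?A n..?A n} = space \<mu> - {x. ?A n < \<bar>x\<bar>}"
        by auto
      then have "measure \<mu> {- ?A n..?A n} = 1 - ?p"
        by (simp only:) (rule law.prob_compl, simp)
      then have "(\<Prod>v\<in>?R. measure \<mu> (B v)) = (1 - ?p) ^ card ?R"
        by (simp add: B_def)
      moreover have "1 + real (card ?R) * (- ?p) \<le> (1 + (- ?p)) ^ card ?R"
        by (rule Bernoulli_inequality) simp
      moreover have "real (card ?R) * ?p \<le> real (card (sites n)) * (C * exp (- \<delta> * ?A n powr \<alpha>))"
        using p C by (intro mult_mono) (auto intro!: card_mono finite_tree_upto)
      ultimately show ?thesis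
        using elim(1) by (simp add: mult_ac)
    qed
    have "(\<Prod>v\<in>S. exp (- (lam + \<eta>) * \<bar>h v\<bar> powr \<alpha> * real n powr (\<alpha> / 2)) / 2) * (1 / 2)
        \<le> (\<Prod>v\<in>S. measure \<mu> (B v)) * (\<Prod>v\<in>?R. measure \<mu> (B v))"
      using window others by (intro mult_mono prod_mono prod_nonneg) auto
    also have "\<dots> = (\<Prod>v\<in>sites n. measure \<mu> (B v))"
      using prod.subset_diff[OF S_sites finite_tree_upto, of "\<lambda>v. measure \<mu> (B v)"] by (simp add: mult.commute)
    also have "\<dots> = (\<Prod>v\<in>sites n. prob (Xs v -` B v \<inter> space M))"
      using tree_upto_subset B_borel by (intro prod.cong prob_Xs[symmetric]) auto
    also have "\<dots> = prob ?E"
      using sites_ne b_ge_2 elim(4) B_borel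
      by (intro indep_varsD[OF indep, symmetric] finite_tree_upto tree_upto_subset) auto
    also have "\<dots> \<le> prob {\<omega> \<in> space M. field_dist b h (Y n \<omega>) < \<epsilon>}"
      using near sites_ne by (intro finite_measure_mono near_event field_supported_on_tree_upto(1)[OF h_off]) auto
    also have "(\<Prod>v\<in>S. exp (- (lam + \<eta>) * \<bar>h v\<bar> powr \<alpha> * real n powr (\<alpha> / 2)) / 2) * (1 / 2)
        = exp (- (lam + \<eta>) * (\<Sum>v\<in>S. \<bar>h v\<bar> powr \<alpha>) * real n powr (\<alpha> / 2)) / 2 ^ Suc (card S)"
      by (simp add: prod_dividef exp_sum[OF S(1), symmetric] sum_distrib_left sum_distrib_right sum_negf)
    finally show ?case .
  qed
qed


text \<open>Truncating \<open>h\<close> to finitely many levels gives \<open>g\<close> within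
  \<open>\<rho> / 2\<close> whose rate is not larger, since terms are only dropped. The ball of
  radius \<open>\<rho> / 2\<close> about \<open>g\<close> lies in \<open>U\<close>, and
  \<open>\<eta>\<close> is finally sent to 0. An infinite rate makes the claim trivial.\<close>

lemma liminf_log_prob_ge:
  assumes U: "openin (field_topology b) U" and h: "h \<in> U"
  shows "- enn2ereal (field_rate b \<alpha> lam h) \<le> liminf (\<lambda>n. log_prob n U)"
proof (cases "field_rate b \<alpha> lam h" rule: ennreal_cases)
  case (real L)
  interpret Metric_space "field_space b" "field_dist b"
    using b_ge_2 by (intro Metric_space_field_space) simp
  have hs: "h \<in> field_space b"
    using U h openin_subset b_ge_2 by (fastforce simp: topspace_field_topology)
  obtain \<rho> where \<rho>: "0 < \<rho>" "mball h \<rho> \<subseteq> U"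
    using U h by (auto simp: field_topology_def openin_mtopology)
  obtain K where K: "field_norm b (\<lambda>v. h v - (if length v \<le> K then h v else 0)) < \<rho> / 2"
    using field_space_truncation[OF hs, of "\<rho> / 2"] \<rho>(1) by auto
  define g where "g = (\<lambda>v. if length v \<le> K then h v else 0)"
  have g_off: "g v = 0" if "v \<notin> tree_upto b K" for v
    using that hs by (auto simp: g_def tree_upto_def field_space_def)
  then have gs: "g \<in> field_space b"
    by (rule field_supported_on_tree_upto)
  have hg: "field_dist b h g < \<rho> / 2"
    using K by (simp add: field_dist_def g_def)
  let ?a = "\<lambda>n. real n powr (\<alpha> / 2)"
  define S where "S = {v \<in> tree_upto b K. g v \<noteq> 0}"
  define H where "H = (\<Sum>v\<in>S. \<bar>g v\<bar> powr \<alpha>)"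
  have H0: "0 \<le> H"
    by (simp add: H_def sum_nonneg)
  have H_le: "lam * H \<le> L"
  proof -
    have "H = (\<Sum>v\<in>S. \<bar>h v\<bar> powr \<alpha>)"
      unfolding H_def by (intro sum.cong) (auto simp: S_def g_def split: if_splits)
    moreover have "S \<subseteq> tree_upto b K"
      by (auto simp: S_def)
    then have "finite S" "S \<subseteq> tree b - {[]}"
      using finite_tree_upto tree_upto_subset by (blast intro: finite_subset)+
    ultimately show ?thesis
      using field_rate_le_iff[OF law.lam_pos real(1), of b \<alpha> h] real(2) by auto
  qed
  have "ereal (- (lam + \<eta>) * H) \<le> liminf (\<lambda>n. log_prob n U)" if \<eta>: "0 < \<eta>" for \<eta>
  proof -
    \<comment> \<open>The logarithm of the bound in \<open>prob_near_ge\<close>; its constant term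
      disappears after division by the speed.\<close>
    let ?r = "\<lambda>n. - (lam + \<eta>) * H * ?a n - real (Suc (card S)) * ln 2"
    have "ereal (- (lam + \<eta>) * H) = liminf (\<lambda>n. ereal (1 / ?a n * ?r n))"
    proof (rule lim_imp_Liminf[symmetric])
      have "(\<lambda>n. 1 / ?a n * ?r n) \<longlonglongrightarrow> - (lam + \<eta>) * H"
        using law.alpha_pos by real_asymp
      then show "(\<lambda>n. ereal (1 / ?a n * ?r n)) \<longlonglongrightarrow> ereal (- (lam + \<eta>) * H)"
        by simp
    qed simp
    also have "\<dots> \<le> liminf (\<lambda>n. log_prob n U)"
    proof (rule Liminf_mono)
      have "\<forall>\<^sub>F n in sequentially. exp (- (lam + \<eta>) * H * ?a n) / 2 ^ Suc (card S)
          \<le> prob {\<omega> \<in> space M. field_dist b g (Y n \<omega>) < \<rho> / 2}"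
        unfolding H_def S_def using \<rho>(1) \<eta> g_off by (intro prob_near_ge) auto
      then show "\<forall>\<^sub>F n in sequentially. ereal (1 / ?a n * ?r n) \<le> log_prob n U"
      proof eventually_elim
        case (elim n)
        have "exp (?r n) = exp (- (lam + \<eta>) * H * ?a n) / 2 ^ Suc (card S)"
          by (simp only: exp_diff exp_of_nat_mult) simp
        also note elim
        also have "prob {\<omega> \<in> space M. field_dist b g (Y n \<omega>) < \<rho> / 2} \<le> prob {\<omega> \<in> space M. Y n \<omega> \<in> U}"
        proof (intro finite_measure_mono Y_event openin_borel_of U subsetI)
          fix \<omega> assume \<omega>: "\<omega> \<in> {\<omega> \<in> space M. field_dist b g (Y n \<omega>) < \<rho> / 2}"
          have "field_dist b h (Y n \<omega>) \<le> field_dist b h g + field_dist b g (Y n \<omega>)"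
            using hs gs Y_space by (rule triangle)
          also have "\<dots> < \<rho>"
            using hg \<omega> by auto
          finally show "\<omega> \<in> {\<omega> \<in> space M. Y n \<omega> \<in> U}"
            using \<rho>(2) hs Y_space \<omega> by auto
        qed
        finally show ?case
          by (rule le_log_prob)
      qed
    qed
    finally show ?thesis .
  qed
  note bound = this
  have "ereal (- L) \<le> liminf (\<lambda>n. log_prob n U)"
  proof (rule ereal_le_epsilon2)
    fix e :: real assume e: "0 < e"
    \<comment> \<open>Chosen so that \<open>\<eta> * H \<le> e\<close>; the summand 1 avoids
      dividing by zero when \<open>g\<close> vanishes.\<close>
    define \<eta> where "\<eta> = e / (H + 1)"
    have \<eta>: "0 < \<eta>" "\<eta> * H \<le> e"
      using e H0 by (auto simp: \<eta>_def field_simps)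
    have "ereal (- L) \<le> ereal (- (lam + \<eta>) * H) + ereal e"
      using H_le \<eta>(2) by (simp add: algebra_simps)
    also have "\<dots> \<le> liminf (\<lambda>n. log_prob n U) + ereal e"
      by (intro add_right_mono bound \<eta>)
    finally show "ereal (- L) \<le> liminf (\<lambda>n. log_prob n U) + ereal e" .
  qed
  then show ?thesis
    using real by (simp add: enn2ereal_ennreal)
qed simp

section \<open>The full principle\<close>

lemma LDP_displacement:
  "LDP M (field_topology b) Y (\<lambda>n. real n powr (\<alpha> / 2)) (field_rate b \<alpha> lam)"
  unfolding LDP_def log_prob_def[symmetric]
proof (intro conjI allI ballI)
  show "prob_space M"
    by (rule prob_space_axioms)
  show "Y n \<in> measurable M (borel_of (field_topology b))" for n
    by (rule measurable_Y)
  show "filterlim (\<lambda>n. real n powr (\<alpha> / 2)) at_top sequentially"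
    using law.alpha_pos by real_asymp
  show "rate_function (field_topology b) (field_rate b \<alpha> lam)"
    using good_rate_function_field_rate[OF b_ge_2 law.alpha_pos law.lam_pos]
    by (simp add: good_rate_function_def)
next
  fix \<Gamma> assume \<Gamma>: "\<Gamma> \<in> sets (borel_of (field_topology b))"
  let ?I = "field_rate b \<alpha> lam" and ?T = "field_topology b"
  show "liminf (\<lambda>n. log_prob n \<Gamma>) \<le> limsup (\<lambda>n. log_prob n \<Gamma>)"
    by (rule Liminf_le_Limsup) simp
  show "- enn2ereal (INF h\<in>?T interior_of \<Gamma>. ?I h) \<le> liminf (\<lambda>n. log_prob n \<Gamma>)"
  proof -
    let ?l = "liminf (\<lambda>n. log_prob n (?T interior_of \<Gamma>))"
    \<comment> \<open>Nonpositive log probabilities make \<open>- ?l\<close> nonnegative, so the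
      conversion to \<open>ennreal\<close> and back loses nothing and the infimum can be handled by
      \<open>INF_greatest\<close>.\<close>
    have "?l \<le> liminf (\<lambda>_. 0)"
      by (intro Liminf_mono always_eventually allI log_prob_nonpos)
    then have l0: "0 \<le> - ?l"
      by (simp add: Liminf_const)
    have "e2ennreal (- ?l) \<le> (INF h\<in>?T interior_of \<Gamma>. ?I h)"
    proof (rule INF_greatest)
      fix h assume "h \<in> ?T interior_of \<Gamma>"
      then have "- enn2ereal (?I h) \<le> ?l"
        by (intro liminf_log_prob_ge openin_interior_of)
      then have "- ?l \<le> enn2ereal (?I h)"
        by (simp add: ereal_uminus_le_reorder)
      then show "e2ennreal (- ?l) \<le> ?I h"
        using e2ennreal_mono by fastforce
    qed
    then have "- ?l \<le> enn2ereal (INF h\<in>?T interior_of \<Gamma>. ?I h)"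
      using l0 by (simp add: less_eq_ennreal.rep_eq enn2ereal_e2ennreal)
    then have "- enn2ereal (INF h\<in>?T interior_of \<Gamma>. ?I h) \<le> ?l"
      by (simp add: ereal_uminus_le_reorder)
    also have "\<dots> \<le> liminf (\<lambda>n. log_prob n \<Gamma>)"
      by (intro Liminf_mono always_eventually allI log_prob_mono interior_of_subset \<Gamma>)
    finally show ?thesis .
  qed
  show "limsup (\<lambda>n. log_prob n \<Gamma>) \<le> - enn2ereal (INF h\<in>?T closure_of \<Gamma>. ?I h)"
  proof -
    let ?C = "?T closure_of \<Gamma>"
    have "\<Gamma> \<subseteq> topspace ?T"
      using sets.sets_into_space[OF \<Gamma>] by (simp add: borel_of_def space_measure_of_conv)
    then have "log_prob n \<Gamma> \<le> log_prob n ?C" for n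
      by (intro log_prob_mono closure_of_subset closedin_borel_of) auto
    then have "limsup (\<lambda>n. log_prob n \<Gamma>) \<le> limsup (\<lambda>n. log_prob n ?C)"
      by (intro Limsup_mono always_eventually) auto
    also have "\<dots> \<le> - enn2ereal (INF h\<in>?C. ?I h)"
    proof -
      let ?s = "limsup (\<lambda>n. log_prob n ?C)"
      have "?s \<le> limsup (\<lambda>_. 0)"
        by (intro Limsup_mono always_eventually allI log_prob_nonpos)
      then have s0: "0 \<le> - ?s"
        by (simp add: Limsup_const)
      have "enn2ereal (INF h\<in>?C. ?I h) \<le> - ?s"
      \<comment> \<open>The closed-set estimate is available for positive reals below the infimum;
        nonpositive \<open>y\<close> are covered by \<open>s0\<close>.\<close>
      proof (rule dense_le)
        fix y assume y: "y < enn2ereal (INF h\<in>?C. ?I h)"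
        show "y \<le> - ?s"
        proof (cases "0 < y")
          case True
          then obtain r where "y = ereal r"
            using y by (cases y) auto
          with True y have "?s \<le> - y"
            using limsup_log_prob_le[of ?C r] by auto
          then show ?thesis
            by (metis ereal_minus_le_minus ereal_uminus_uminus)
        next
          case False
          then have "y \<le> 0"
            by simp
          then show ?thesis
            using s0 by (rule order_trans)
        qed
      qed
      then show ?thesis
        by (metis ereal_minus_le_minus ereal_uminus_uminus)
    qed
    finally show ?thesis .
  qed
qed

end

theorem theorem3p4:
  fixes b :: nat and \<alpha> lam c :: real
    and N :: "'x measure" and X :: "'x \<Rightarrow> real"
    and M :: "'a measure" and Xs :: "nat list \<Rightarrow> 'a \<Rightarrow> real"
  assumes b: "2 \<le> b"
    and alpha: "0 < \<alpha>" and lam: "0 < lam"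
    and N: "prob_space N" and X: "X \<in> borel_measurable N"
    and symmetric: "distr N borel (\<lambda>\<omega>. - X \<omega>) = distr N borel X"
    and mean: "integrable N X" "prob_space.expectation N X = 0"
    and second_moment: "integrable N (\<lambda>\<omega>. (X \<omega>)\<^sup>2)" "prob_space.expectation N (\<lambda>\<omega>. (X \<omega>)\<^sup>2) = 1"
    and tail: "((\<lambda>x. ereal (x powr (- \<alpha>)) * ext_ln (measure N {\<omega> \<in> space N. X \<omega> > x}))
                 \<longlongrightarrow> ereal (- lam)) at_top"
    and M: "prob_space M"
    and indep: "prob_space.indep_vars M (\<lambda>_. borel) Xs (tree b - {[]})"
    and copies: "\<And>v. v \<in> tree b - {[]} \<Longrightarrow> distr M borel (Xs v) = distr N borel X"
    and c_small: "\<alpha> < 1 \<Longrightarrow> \<alpha> / (2 * ln (real b)) < c \<and> c < \<alpha> / (2 * (1 - \<alpha>) * ln (real b))"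
    and c_large: "1 \<le> \<alpha> \<Longrightarrow> \<alpha> / (2 * ln (real b)) < c"
  shows "LDP M (field_topology b) (displacement b c Xs) (\<lambda>n. real n powr (\<alpha> / 2)) (field_rate b \<alpha> lam)
       \<and> good_rate_function (field_topology b) (field_rate b \<alpha> lam)"
proof
  let ?\<mu> = "distr N borel X"
  have "real_distribution ?\<mu>"
    using N X by (rule prob_space.real_distribution_distr)
  moreover have "weibull_law_axioms ?\<mu> \<alpha> lam"
  proof
    show "distr ?\<mu> borel uminus = ?\<mu>"
      using X symmetric by (simp add: distr_distr o_def)
    have "measure ?\<mu> {x<..} = measure N {\<omega> \<in> space N. X \<omega> > x}" for x
      using X by (subst measure_distr) (auto intro!: arg_cong[where f = "measure N"])
    then show "((\<lambda>x. ereal (x powr - \<alpha>) * ext_ln (measure ?\<mu> {x<..})) \<longlongrightarrow> ereal (- lam)) at_top"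
      using tail by simp
  qed (fact alpha lam)+
  ultimately have law: "weibull_law ?\<mu> \<alpha> lam"
    by (rule weibull_law.intro)
  \<comment> \<open>In both ranges of \<open>\<alpha>\<close> this number is a lower bound for
    \<open>c\<close>; positivity of \<open>c\<close> makes the cutoff tend to infinity.\<close>
  have "0 < \<alpha> / (2 * ln (real b))"
    using b alpha by simp
  then have c: "0 < c"
    using c_small c_large by (cases "\<alpha> < 1") auto
  have "iid_displacements M ?\<mu> \<alpha> lam b c Xs"
    using M law b c indep copies
    by (intro iid_displacements.intro iid_displacements_axioms.intro) auto
  then show "LDP M (field_topology b) (displacement b c Xs) (\<lambda>n. real n powr (\<alpha> / 2)) (field_rate b \<alpha> lam)"
    by (rule iid_displacements.LDP_displacement)
  show "good_rate_function (field_topology b) (field_rate b \<alpha> lam)"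
    using b alpha lam by (rule good_rate_function_field_rate)
qed

end
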